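(* Let $n\in\mathbb{N}$ and let $K\subset\mathbb{R}^n$ be a $0$-symmetric convex body. Then \[ G(K)\le 3^{n-1}\bigl(G(\operatorname{int}K)+2\bigr). \] Moreover, equality holds if and only if $K$ is unimodularly equivalent to the parallelepiped $[-1,1]^{n-1}\times[-\ell,\ell]$ for some $\ell\in\mathbb{N}$.
   Context: A convex body in $\mathbb{R}^n$ is a compact convex set with nonempty interior; it is $0$-symmetric if $K=-K$. For $S\subset\mathbb{R}^n$, $G(S)=|S\cap\mathbb{Z}^n|$ denotes the number of integer points in $S$, and $\operatorname{int}K$ is the interior of $K$. Two sets $K,K'$ are unimodularly equivalent if $K=AK'=\{Ax:x\in K'\}$ for some integer matrix $A\in\mathbb{Z}^{n\times n}$ whose inverse is also an integer matrix. *)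

theory Defs
  imports "HOL-Analysis.Analysis"
begin

definition int_point :: "real^'n \<Rightarrow> bool" where
  "int_point x \<longleftrightarrow> (\<forall>i. x $ i \<in> \<int>)"

definition G :: "(real^'n) set \<Rightarrow> nat" where
  "G S = card (S \<inter> {x. int_point x})"

definition convex_body :: "(real^'n) set \<Rightarrow> bool" where
  "convex_body K \<longleftrightarrow> compact K \<and> convex K \<and> interior K \<noteq> {}"

definition origin_symmetric :: "(real^'n) set \<Rightarrow> bool" where
  "origin_symmetric K \<longleftrightarrow> uminus ` K = K"

definition int_matrix :: "real^'n^'n \<Rightarrow> bool" where
  "int_matrix A \<longleftrightarrow> (\<forall>i j. A $ i $ j \<in> \<int>)"

definition unimodular :: "real^'n^'n \<Rightarrow> bool" where
  "unimodular A \<longleftrightarrow> int_matrix A \<and> invertible A \<and> int_matrix (matrix_inv A)"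

definition unimod_equiv :: "(real^'n) set \<Rightarrow> (real^'n) set \<Rightarrow> bool" where
  "unimod_equiv K K' \<longleftrightarrow> (\<exists>A. unimodular A \<and> K = (\<lambda>x. A *v x) ` K')"

definition para :: "'n \<Rightarrow> nat \<Rightarrow> (real^'n) set" where
  "para j l = {x. \<forall>i. \<bar>x $ i\<bar> \<le> (if i = j then real l else 1)}"

end

theory Submission
  imports Defs
begin

text \<open>Let \<open>P\<close> be the set of lattice points of \<open>K\<close>. If two points of \<open>P\<close> are congruent modulo 3, a third of their
  difference is an interior lattice point.

  If the origin is the only interior lattice point, \<open>P\<close> is thus injective modulo 3, which is Minkowski's
  bound. In the case of equality, for \<open>x, y \<in> P\<close> choose \<open>z \<in> P\<close> congruent to \<open>x + y\<close>; then either \<open>x + y = z\<close>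
  or \<open>(x + y - z) / 3\<close> is a boundary lattice point all of whose supporting hyperplanes contain \<open>x\<close> and \<open>y\<close>.
  Boundary lattice points with an inclusion-minimal set of supporting hyperplanes are therefore the
  facet centres of a unimodular cube: their functionals only take the values \<open>-1, 0, 1\<close> on \<open>P\<close>, they are
  dual to each other and separate \<open>P\<close>, and \<open>P\<close> has \<open>3\<^sup>n\<close> points.

  Otherwise let \<open>w\<close> be a primitive interior lattice point and consider each of the \<open>3\<^sup>n\<^sup>-\<^sup>1\<close> classes of \<open>P\<close> modulo
  the lattice generated by \<open>3\<int>\<^sup>n\<close> and \<open>w\<close>. A class consists of segments parallel to \<open>w\<close>. A third of the
  difference of two segments, fattened by the interior multiples of \<open>w\<close>, supplies interior lattice points;
  pairing off the segments shows that a class has at most two points more than the interior, with equality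
  only for a single segment of maximal length. If all classes are such segments, then shrinking \<open>K\<close> along
  \<open>w\<close> reduces the characterisation of equality to the first case.\<close>

subsection \<open>The integer lattice modulo 3\<close>

lemma int_point_0 [simp]: "int_point 0"
  by (simp add: int_point_def)

lemma int_point_add: "int_point x \<Longrightarrow> int_point y \<Longrightarrow> int_point (x + y)"
  by (simp add: int_point_def)

lemma int_point_minus [simp]: "int_point (- x) \<longleftrightarrow> int_point x"
  by (simp add: int_point_def)

lemma int_point_diff: "int_point x \<Longrightarrow> int_point y \<Longrightarrow> int_point (x - y)"
  by (simp add: int_point_def)

lemma int_point_scale: "int_point x \<Longrightarrow> int_point (of_int k *\<^sub>R x)"
  by (simp add: int_point_def)

lemma int_point_sum: "(\<And>i. i \<in> S \<Longrightarrow> int_point (f i)) \<Longrightarrow> int_point (\<Sum>i\<in>S. f i)"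
  by (induction S rule: infinite_finite_induct) (auto intro: int_point_add)

lemma finite_int_points:
  fixes S :: "(real^'n) set"
  assumes "bounded S"
  shows "finite (S \<inter> {x. int_point x})"
proof -
  obtain B where B: "\<And>x. x \<in> S \<Longrightarrow> norm x \<le> B"
    using assms by (auto simp: bounded_iff)
  define N where "N = \<lceil>B\<rceil>"
  have "S \<inter> {x. int_point x} \<subseteq> (\<lambda>f. \<chi> i. of_int (f i)) ` (PiE UNIV (\<lambda>i::'n. {-N..N}))"
  proof
    fix x assume x: "x \<in> S \<inter> {x. int_point x}"
    have 1: "of_int \<lfloor>x $ i\<rfloor> = x $ i" for i
      using x by (simp add: int_point_def)
    have "\<bar>x $ i\<bar> \<le> B" for i
      using B[of x] component_le_norm_cart[of x i] x by auto
    then have "\<bar>of_int \<lfloor>x $ i\<rfloor>\<bar> \<le> B" for i unfolding 1 .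
    then have "\<lfloor>x $ i\<rfloor> \<in> {-N..N}" for i
      unfolding N_def using le_of_int_ceiling[of B] by (smt (verit) atLeastAtMost_iff of_int_le_iff of_int_minus)
    then have mem: "(\<lambda>i. \<lfloor>x $ i\<rfloor>) \<in> PiE UNIV (\<lambda>i::'n. {-N..N})" by auto
    show "x \<in> (\<lambda>f. \<chi> i. of_int (f i)) ` (PiE UNIV (\<lambda>i::'n. {-N..N}))"
      by (rule image_eqI[OF _ mem]) (unfold vec_eq_iff vec_lambda_beta 1, blast)
  qed
  then show ?thesis
    by (rule finite_subset) (auto intro!: finite_imageI finite_PiE)
qed

text \<open>The floor turns the coordinates of a lattice point into integers. This form serves to
  count residue classes; \<open>cong3\<close> expresses the same congruence of lattice points in a
  form compatible with vector operations.\<close>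

definition res3 :: "real^'n \<Rightarrow> 'n \<Rightarrow> int" where
  "res3 x = (\<lambda>i. \<lfloor>x $ i\<rfloor> mod 3)"

definition cong3 :: "real^'n \<Rightarrow> real^'n \<Rightarrow> bool" where
  "cong3 x y \<longleftrightarrow> int_point ((1/3) *\<^sub>R (x - y))"

lemma third_Ints_iff: "of_int a / (3::real) \<in> \<int> \<longleftrightarrow> a mod 3 = 0"
proof
  assume "of_int a / (3::real) \<in> \<int>"
  then obtain k where "of_int a / (3::real) = of_int k" by (auto elim: Ints_cases)
  then have "(of_int a :: real) = of_int (3 * k)" by (simp add: field_simps)
  then have "a = 3 * k" by (simp only: of_int_eq_iff)
  then show "a mod 3 = 0" by simp
next
  assume "a mod 3 = 0"
  then obtain k where "a = 3 * k" by auto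
  then show "of_int a / (3::real) \<in> \<int>" by simp
qed

lemma res3_eq_iff:
  assumes "int_point x" "int_point y"
  shows "res3 x = res3 y \<longleftrightarrow> cong3 x y"
proof -
  have "\<lfloor>x $ i\<rfloor> mod 3 = \<lfloor>y $ i\<rfloor> mod 3 \<longleftrightarrow> (x $ i - y $ i) / 3 \<in> \<int>" for i
  proof -
    obtain a where a: "x $ i = of_int a" using assms(1) unfolding int_point_def by (meson Ints_cases)
    obtain b where b: "y $ i = of_int b" using assms(2) unfolding int_point_def by (meson Ints_cases)
    show ?thesis
      using third_Ints_iff[of "a - b"] by (simp add: a b mod_eq_dvd_iff dvd_eq_mod_eq_0)
  qed
  then show ?thesis
    by (simp add: res3_def fun_eq_iff cong3_def int_point_def)
qed

lemma cong3_refl [simp]: "cong3 x x"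
  by (simp add: cong3_def)

lemma cong3_sym: "cong3 x y \<Longrightarrow> cong3 y x"
  using int_point_minus[of "(1/3) *\<^sub>R (x - y)"] by (simp add: cong3_def scaleR_diff_right)

lemma cong3_add: "cong3 x y \<Longrightarrow> cong3 x' y' \<Longrightarrow> cong3 (x + x') (y + y')"
  using int_point_add[of "(1/3) *\<^sub>R (x - y)" "(1/3) *\<^sub>R (x' - y')"]
  by (simp add: cong3_def algebra_simps)

lemma cong3_trans: "cong3 x y \<Longrightarrow> cong3 y z \<Longrightarrow> cong3 x z"
  using int_point_add[of "(1/3) *\<^sub>R (x - y)" "(1/3) *\<^sub>R (y - z)"]
  by (simp add: cong3_def algebra_simps)

lemma cong3_int_mod:
  assumes "int_point w" "(a::int) mod 3 = b mod 3"
  shows "cong3 (of_int a *\<^sub>R w) (of_int b *\<^sub>R w)"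
proof -
  obtain k where "a - b = 3 * k"
    using assms(2) by (metis dvdE mod_eq_dvd_iff)
  then have "a = b + 3 * k" by simp
  then have "(1/3) *\<^sub>R (of_int a *\<^sub>R w - of_int b *\<^sub>R w) = of_int k *\<^sub>R w"
    by (simp add: algebra_simps)
  then show ?thesis
    using assms(1) int_point_scale unfolding cong3_def by metis
qed

lemma card_residues: "card (PiE (UNIV::'n::finite set) (\<lambda>_. {0..<3::int})) = 3 ^ CARD('n)"
  by (simp add: card_PiE)

lemma finite_residues: "finite (PiE (UNIV::'n::finite set) (\<lambda>_. {0..<3::int}))"
  by (auto intro!: finite_PiE)

lemma res3_in: "res3 (x::real^'n) \<in> PiE UNIV (\<lambda>_. {0..<3})"
  by (auto simp: res3_def)

lemma res3_of_int_vec: "f \<in> PiE UNIV (\<lambda>_. {0..<3}) \<Longrightarrow> res3 (\<chi> i. of_int (f i)) = f"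
  unfolding res3_def by (rule ext) (auto simp: PiE_iff)

subsection \<open>Symmetric convex bodies\<close>

locale symmetric_body =
  fixes K :: "(real^'n) set"
  assumes compact: "compact K"
    and convex: "convex K"
    and symmetric: "x \<in> K \<Longrightarrow> - x \<in> K"
    and zero_interior: "0 \<in> interior K"
begin

lemma interior_minus: "x \<in> interior K \<Longrightarrow> - x \<in> interior K"
proof -
  assume x: "x \<in> interior K"
  have "uminus ` K = K" using symmetric by force
  then have "interior K = uminus ` interior K"
    by (metis interior_negations)
  then show ?thesis using x by auto
qed

lemma interior_comb:
  assumes "x \<in> K" "y \<in> interior K" "0 < t" "t \<le> 1"
  shows "(1 - t) *\<^sub>R x + t *\<^sub>R y \<in> interior K"
  using mem_interior_convex_shrink[OF convex assms(2,1,3,4)] by (simp add: algebra_simps)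

lemma scale_interior:
  assumes "x \<in> K" "\<bar>t\<bar> < 1"
  shows "t *\<^sub>R x \<in> interior K"
proof -
  have *: "t *\<^sub>R x \<in> interior K" if "0 \<le> t" "t < 1" for t
    using interior_comb[OF assms(1) zero_interior, of "1 - t"] that by simp
  show ?thesis
  proof (cases "0 \<le> t")
    case True then show ?thesis using * assms(2) by auto
  next
    case False
    then have "- t *\<^sub>R x \<in> interior K" using *[of "- t"] assms(2) by auto
    then show ?thesis using interior_minus by fastforce
  qed
qed

lemma third_in:
  assumes "x \<in> K" "y \<in> K" "z \<in> K"
  shows "(1/3) *\<^sub>R (x + y + z) \<in> K"
proof -
  have "(1/2) *\<^sub>R x + (1/2) *\<^sub>R y \<in> K"
    using convexD[OF convex assms(1,2)] by simp
  then have "(2/3) *\<^sub>R ((1/2) *\<^sub>R x + (1/2) *\<^sub>R y) + (1/3) *\<^sub>R z \<in> K"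
    using convexD[OF convex _ assms(3)] by simp
  then show ?thesis by (simp add: algebra_simps)
qed

lemma third_interior:
  assumes "x \<in> K" "y \<in> K" "z \<in> interior K"
  shows "(1/3) *\<^sub>R (x + y + z) \<in> interior K"
proof -
  have "(1/2) *\<^sub>R x + (1/2) *\<^sub>R y \<in> K"
    using convexD[OF convex assms(1,2)] by simp
  from interior_comb[OF this assms(3), of "1/3"] show ?thesis
    by (simp add: algebra_simps)
qed

text \<open>The centroid of \<open>x\<close>, \<open>-y\<close> and the interior point 0. It is a
  lattice point exactly when \<open>cong3 x y\<close> holds, so congruent lattice points yield
  interior ones.\<close>

lemma third_diff_interior:
  assumes "x \<in> K" "y \<in> K"
  shows "(1/3) *\<^sub>R (x - y) \<in> interior K"
  using third_interior[OF assms(1) symmetric[OF assms(2)] zero_interior] by simp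

lemma supporting_functional:
  assumes "z \<in> K" "z \<notin> interior K"
  obtains a where "\<And>y. y \<in> K \<Longrightarrow> a \<bullet> y \<le> 1" "a \<bullet> z = 1"
proof -
  have ri: "rel_interior K = interior K"
    using rel_interior_nonempty_interior zero_interior by blast
  obtain a where a: "a \<noteq> 0" "\<And>y. y \<in> K \<Longrightarrow> a \<bullet> z \<le> a \<bullet> y"
      "\<And>y. y \<in> interior K \<Longrightarrow> a \<bullet> z < a \<bullet> y"
    using supporting_hyperplane_rel_boundary[OF convex assms(1)] assms(2) ri by metis
  \<comment> \<open>The hyperplane through \<open>z\<close> misses the interior point 0, so the
    value at \<open>z\<close> can be normalised to 1; dividing by a negative number turns the
    minimum at \<open>z\<close> into a maximum.\<close>
  have neg: "a \<bullet> z < 0" using a(3)[OF zero_interior] by simp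
  show ?thesis
  proof
    show "((1 / (a \<bullet> z)) *\<^sub>R a) \<bullet> z = 1" using neg by simp
    show "((1 / (a \<bullet> z)) *\<^sub>R a) \<bullet> y \<le> 1" if "y \<in> K" for y
      using neg a(2)[OF that] by (simp add: field_simps)
  qed
qed

lemma abs_functional_le:
  assumes "\<And>y. y \<in> K \<Longrightarrow> a \<bullet> y \<le> 1" "x \<in> K"
  shows "\<bar>a \<bullet> x\<bar> \<le> 1"
  using assms(1)[OF assms(2)] assms(1)[OF symmetric[OF assms(2)]] by auto

definition pts :: "(real^'n) set" where "pts = K \<inter> {x. int_point x}"

definition ipts :: "(real^'n) set" where "ipts = interior K \<inter> {x. int_point x}"

lemma card_pts: "card pts = G K" by (simp add: pts_def G_def)

lemma card_ipts: "card ipts = G (interior K)" by (simp add: ipts_def G_def)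

lemma finite_pts: "finite pts"
  unfolding pts_def by (rule finite_int_points) (simp add: compact compact_imp_bounded)

lemma ipts_subset: "ipts \<subseteq> pts"
  using interior_subset by (auto simp: pts_def ipts_def)

lemma finite_ipts: "finite ipts"
  using finite_pts ipts_subset finite_subset by blast

lemma zero_ipts: "0 \<in> ipts" using zero_interior by (simp add: ipts_def)

lemma minus_pts: "x \<in> pts \<Longrightarrow> - x \<in> pts" using symmetric by (simp add: pts_def)

lemma minus_ipts: "x \<in> ipts \<Longrightarrow> - x \<in> ipts" using interior_minus by (simp add: ipts_def)

end

lemma symmetric_bodyI:
  assumes "convex_body K" "origin_symmetric K"
  shows "symmetric_body K"
proof
  show "compact K" "convex K" using assms(1) by (auto simp: convex_body_def)
  show s: "- x \<in> K" if "x \<in> K" for x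
    using assms(2) that unfolding origin_symmetric_def by blast
  obtain x where x: "x \<in> interior K" using assms(1) by (auto simp: convex_body_def)
  have "interior K = uminus ` interior K"
    using assms(2) interior_negations[of K] by (simp add: origin_symmetric_def)
  then have "- x \<in> interior K" using x by auto
  then have "(1/2) *\<^sub>R x + (1/2) *\<^sub>R (- x) \<in> interior K"
    using convexD[OF convex_interior[OF \<open>convex K\<close>] x, of "-x" "1/2" "1/2"] by simp
  then show "0 \<in> interior K" by simp
qed

text \<open>Encodes a unimodular change of coordinates: the \<open>f i\<close> are the columns of a
  unimodular matrix and the \<open>a i\<close> are the rows of its inverse.\<close>

definition dual_lattice_bases :: "('n \<Rightarrow> real^'n) \<Rightarrow> ('n \<Rightarrow> real^'n) \<Rightarrow> bool" where
  "dual_lattice_bases f a \<longleftrightarrow> (\<forall>i. int_point (f i)) \<and> (\<forall>i v. int_point v \<longrightarrow> a i \<bullet> v \<in> \<int>)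
     \<and> (\<forall>i j. a i \<bullet> f j = (if i = j then 1 else 0)) \<and> (\<forall>x. (\<Sum>i\<in>UNIV. (a i \<bullet> x) *\<^sub>R f i) = x)"

subsection \<open>Bodies with a single interior lattice point meeting all residue classes\<close>

text \<open>The equality case of Minkowski's bound, stated by residue classes instead of
  cardinalities so that it can also be applied to the shrunken body \<open>core\<close>.\<close>

locale full_body = symmetric_body K for K :: "(real^'n) set" +
  assumes interior_trivial: "x \<in> interior K \<Longrightarrow> int_point x \<Longrightarrow> x = 0"
    and all_residues: "int_point v \<Longrightarrow> \<exists>p\<in>pts. cong3 p v"
begin

text \<open>The face of the polar body dual to \<open>x\<close>.\<close>

definition normals :: "real^'n \<Rightarrow> (real^'n) set" where
  "normals x = {a. (\<forall>y\<in>K. a \<bullet> y \<le> 1) \<and> a \<bullet> x = 1}"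

text \<open>Since 0 is the only interior lattice point, these are the lattice points on the boundary
  of \<open>K\<close>.\<close>

definition bpts :: "(real^'n) set" where "bpts = pts - {0}"

text \<open>The smoothest lattice points; they turn out to be the facet centres of the cube.\<close>

definition centres :: "(real^'n) set" where
  "centres = {x \<in> bpts. \<forall>y\<in>bpts. normals y \<subseteq> normals x \<longrightarrow> normals y = normals x}"

lemma normals_abs_le: "a \<in> normals x \<Longrightarrow> y \<in> K \<Longrightarrow> \<bar>a \<bullet> y\<bar> \<le> 1"
  by (rule abs_functional_le) (auto simp: normals_def)

lemma pts_in: "x \<in> pts \<Longrightarrow> x \<in> K" by (simp add: pts_def)

text \<open>Choosing a lattice point \<open>z\<close> congruent to \<open>x + y\<close>, the centroid of \<open>x, y, -z\<close> is a lattice point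
  of \<open>K\<close>; if it is not the origin, it lies on every supporting hyperplane only together with \<open>x\<close> and \<open>y\<close>.\<close>

lemma sum_or_face:
  assumes x: "x \<in> pts" and y: "y \<in> pts"
  shows "x + y \<in> pts \<or> (\<exists>u\<in>bpts. normals u \<subseteq> normals x \<inter> normals y)"
proof -
  have "int_point (x + y)" using x y by (auto simp: pts_def intro: int_point_add)
  then obtain z where z: "z \<in> pts" "cong3 z (x + y)" using all_residues by blast
  define u where "u = (1/3) *\<^sub>R (x + y - z)"
  have "int_point u" using cong3_sym[OF z(2)] by (simp add: cong3_def u_def)
  moreover have "u \<in> K"
    using third_in[OF pts_in[OF x] pts_in[OF y] symmetric[OF pts_in[OF z(1)]]] by (simp add: u_def)
  ultimately have u: "u \<in> pts" by (simp add: pts_def)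
  have "normals u \<subseteq> normals x \<inter> normals y"
  proof
    fix a assume a: "a \<in> normals u"
    have "a \<bullet> u = 1" using a by (simp add: normals_def)
    \<comment> \<open>Three numbers of absolute value at most 1 contribute to this 3, so
      \<open>a\<close> takes the value 1 at both \<open>x\<close> and \<open>y\<close>.\<close>
    then have "a \<bullet> x + a \<bullet> y - a \<bullet> z = 3"
      by (simp add: u_def inner_diff_right inner_add_right)
    then show "a \<in> normals x \<inter> normals y"
      using a normals_abs_le[OF a pts_in[OF x]] normals_abs_le[OF a pts_in[OF y]]
        normals_abs_le[OF a pts_in[OF z(1)]] by (auto simp: normals_def)
  qed
  moreover have "x + y = z" if "u = 0" using that by (simp add: u_def)
  ultimately show ?thesis using u z(1) by (cases "u = 0") (auto simp: bpts_def)
qed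

lemma normals_nonempty:
  assumes "u \<in> bpts" obtains a where "a \<in> normals u"
proof -
  have "u \<in> K" "u \<notin> interior K" using assms interior_trivial by (auto simp: bpts_def pts_def)
  then obtain a where "\<And>y. y \<in> K \<Longrightarrow> a \<bullet> y \<le> 1" "a \<bullet> u = 1"
    using supporting_functional by blast
  then show ?thesis by (intro that[of a]) (simp add: normals_def)
qed

lemma exists_centre:
  assumes "u \<in> bpts" obtains x where "x \<in> centres" "normals x \<subseteq> normals u"
proof -
  have "finite (normals ` bpts)" using finite_pts by (simp add: bpts_def)
  from finite_has_minimal2[OF this, of "normals u"] assms
  obtain N where "N \<in> normals ` bpts" "N \<subseteq> normals u" "\<forall>N'\<in>normals ` bpts. N' \<subseteq> N \<longrightarrow> N = N'"
    by auto
  moreover from this obtain x where "x \<in> bpts" "N = normals x" by blast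
  ultimately show ?thesis by (intro that[of x]) (auto simp: centres_def)
qed

lemma normals_minus: "a \<in> normals (- x) \<longleftrightarrow> - a \<in> normals x"
  using symmetric by (fastforce simp: normals_def)

lemma normals_minus_mono: "normals x \<subseteq> normals y \<Longrightarrow> normals (- x) \<subseteq> normals (- y)"
  using normals_minus by blast

lemma centres_minus:
  assumes "x \<in> centres" shows "- x \<in> centres"
proof -
  have "normals y = normals (- x)" if y: "y \<in> bpts" "normals y \<subseteq> normals (- x)" for y
  proof -
    have "- y \<in> bpts" using y(1) minus_pts by (auto simp: bpts_def)
    moreover have "normals (- y) \<subseteq> normals x" using normals_minus_mono[OF y(2)] by simp
    ultimately have "normals (- y) = normals x" using assms by (auto simp: centres_def)
    then have "normals (- x) \<subseteq> normals y" using normals_minus_mono[of x "- y"] by simp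
    then show ?thesis using y(2) by blast
  qed
  then show ?thesis using assms minus_pts by (auto simp: centres_def bpts_def)
qed

lemma centres_pts: "x \<in> centres \<Longrightarrow> x \<in> pts"
  by (auto simp: centres_def bpts_def)

section \<open>Values of the normals of centres at lattice points\<close>

lemma normals_sum_notin:
  assumes "a \<in> normals x" "a \<in> normals y" shows "x + y \<notin> pts"
  using assms by (force simp: normals_def pts_def inner_add_right)

text \<open>The common normal would be 2 at \<open>x + p\<close>, so \<open>sum_or_face\<close>
  supplies a boundary lattice point whose normals are shared by \<open>x\<close> and
  \<open>p\<close>; by minimality of the centre these are all normals of \<open>x\<close>.\<close>

lemma centre_normals_subset:
  assumes "x \<in> centres" "p \<in> pts" "a \<in> normals x" "a \<in> normals p"
  shows "normals x \<subseteq> normals p"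
proof -
  obtain u where u: "u \<in> bpts" "normals u \<subseteq> normals x \<inter> normals p"
    using sum_or_face[OF centres_pts[OF assms(1)] assms(2)] normals_sum_notin[OF assms(3,4)] by blast
  then show ?thesis using assms(1) unfolding centres_def by blast
qed

text \<open>As long as the value at a lattice point of \<open>K\<close> is not 1, adding
  \<open>x\<close> stays in \<open>pts\<close> and raises the value by 1. From a value other than 0
  and 1 two such additions are possible, and the upper bound 1 then leaves only the value
  -1.\<close>

lemma centre_values:
  assumes x: "x \<in> centres" and a: "a \<in> normals x" and p: "p \<in> pts"
  shows "a \<bullet> p \<in> {-1, 0, 1}"
proof -
  have step: "a \<bullet> q = 1 \<or> q + x \<in> pts" if q: "q \<in> pts" for q
  proof (rule ccontr)
    assume n: "\<not> ?thesis"
    then obtain u where u: "u \<in> bpts" "normals u \<subseteq> normals x \<inter> normals q"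
      using sum_or_face[OF centres_pts[OF x] q] by (auto simp: add.commute)
    then have "normals u = normals x" using x by (auto simp: centres_def)
    then have "a \<in> normals q" using u a by auto
    then show False using n by (simp add: normals_def)
  qed
  have ax: "a \<bullet> x = 1" using a by (simp add: normals_def)
  have bound: "\<bar>a \<bullet> q\<bar> \<le> 1" if "q \<in> pts" for q
    using normals_abs_le[OF a pts_in[OF that]] .
  have e: "a \<bullet> (p + x) = a \<bullet> p + 1" "a \<bullet> (p + x + x) = a \<bullet> p + 2"
    by (simp_all only: inner_add_right ax)
  show ?thesis
  proof (cases "a \<bullet> p = 1 \<or> a \<bullet> p = 0")
    case False
    then have "p + x + x \<in> pts"
      using step[OF p] step[of "p + x"] e by auto
    then show ?thesis using bound[OF p] bound[of "p + x + x"] e by auto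
  qed auto
qed

lemma centres_share_normal:
  assumes "x \<in> centres" "y \<in> centres" "a \<in> normals x" "a \<in> normals y"
  shows "normals x = normals y"
  using centre_normals_subset[OF assms(1) centres_pts[OF assms(2)] assms(3,4)]
    centre_normals_subset[OF assms(2) centres_pts[OF assms(1)] assms(4,3)] by blast

text \<open>Apply \<open>sum_or_face\<close> to \<open>p\<close> and \<open>-p'\<close>: either
  \<open>p - p'\<close> is itself a boundary lattice point, or some boundary lattice point has all
  its normals in common with \<open>p\<close> and \<open>-p'\<close>. A centre with fewer normals
  inherits these values.\<close>

lemma separating_centre:
  assumes "p \<in> pts" "p' \<in> pts" "p \<noteq> p'"
  obtains x where "x \<in> centres"
    "\<And>a. a \<in> normals x \<Longrightarrow> a \<bullet> p - a \<bullet> p' = 1 \<or> a \<bullet> p = 1 \<and> a \<bullet> p' = -1"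
proof -
  have "p + - p' \<in> pts \<or> (\<exists>u\<in>bpts. normals u \<subseteq> normals p \<inter> normals (- p'))"
    by (rule sum_or_face[OF assms(1) minus_pts[OF assms(2)]])
  then show ?thesis
  proof
    assume "p + - p' \<in> pts"
    then have "p - p' \<in> bpts" using assms(3) by (simp add: bpts_def)
    then obtain x where "x \<in> centres" "normals x \<subseteq> normals (p - p')"
      using exists_centre by blast
    then have "a \<bullet> p - a \<bullet> p' = 1" if "a \<in> normals x" for a
      using that unfolding normals_def inner_diff_right by blast
    then show ?thesis using that \<open>x \<in> centres\<close> by blast
  next
    assume "\<exists>u\<in>bpts. normals u \<subseteq> normals p \<inter> normals (- p')"
    then obtain x where "x \<in> centres" "normals x \<subseteq> normals p \<inter> normals (- p')"
      using exists_centre by (metis subset_trans)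
    then have "a \<bullet> p = 1 \<and> a \<bullet> p' = -1" if "a \<in> normals x" for a
      using that unfolding normals_def by fastforce
    then show ?thesis using that \<open>x \<in> centres\<close> by blast
  qed
qed

text \<open>A normal of a separating centre has values 1 and 0, 0 and -1, or 1 and -1 at
  \<open>x\<close> and \<open>y\<close>. Hence it is normal at \<open>x\<close> but not at
  \<open>y\<close>, or at \<open>-y\<close> but not at \<open>-x\<close>.\<close>

lemma centres_normals_inj:
  assumes x: "x \<in> centres" and y: "y \<in> centres" and eq: "normals x = normals y"
  shows "x = y"
proof (rule ccontr)
  assume "x \<noteq> y"
  then obtain z where z: "z \<in> centres"
    "\<And>a. a \<in> normals z \<Longrightarrow> a \<bullet> x - a \<bullet> y = 1 \<or> a \<bullet> x = 1 \<and> a \<bullet> y = -1"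
    using separating_centre[OF centres_pts[OF x] centres_pts[OF y]] by blast
  obtain a where a: "a \<in> normals z"
    using normals_nonempty z(1) by (auto simp: centres_def)
  have bd: "\<forall>y\<in>K. a \<bullet> y \<le> 1" using a by (simp add: normals_def)
  have eq': "normals (- x) = normals (- y)"
    using normals_minus_mono[of x y] normals_minus_mono[of y x] eq by blast
  have "a \<bullet> x = 1 \<or> a \<bullet> y = -1"
    using z(2)[OF a] centre_values[OF z(1) a centres_pts[OF x]] centre_values[OF z(1) a centres_pts[OF y]]
    by auto
  then show False
  proof
    assume "a \<bullet> x = 1"
    then have "a \<in> normals x" using bd by (simp add: normals_def)
    then have "a \<in> normals y" using eq by simp
    then show False using z(2)[OF a] \<open>a \<bullet> x = 1\<close> by (simp add: normals_def)
  next
    assume "a \<bullet> y = -1"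
    then have "a \<in> normals (- y)" using bd by (simp add: normals_def)
    then have "a \<in> normals (- x)" using eq' by simp
    then show False using z(2)[OF a] \<open>a \<bullet> y = -1\<close> by (simp add: normals_def)
  qed
qed

text \<open>A value 1 or -1 would make \<open>a\<close> a common normal of \<open>x\<close> and of
  \<open>y\<close> or \<open>-y\<close>; centres with a common normal coincide.\<close>

lemma centres_orthogonal:
  assumes x: "x \<in> centres" and y: "y \<in> centres" and a: "a \<in> normals x" and ne: "y \<noteq> x" "y \<noteq> - x"
  shows "a \<bullet> y = 0"
proof -
  have bd: "\<forall>y\<in>K. a \<bullet> y \<le> 1" using a by (simp add: normals_def)
  have "a \<bullet> y \<noteq> 1"
  proof
    assume "a \<bullet> y = 1"
    then have "a \<in> normals y" using bd by (simp add: normals_def)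
    then show False
      using centres_normals_inj[OF x y] centres_share_normal[OF x y a] ne by simp
  qed
  moreover have "a \<bullet> y \<noteq> -1"
  proof
    assume "a \<bullet> y = -1"
    then have "a \<in> normals (- y)" using bd by (simp add: normals_def)
    then have "x = - y"
      using centres_normals_inj[OF x centres_minus[OF y]] centres_share_normal[OF x centres_minus[OF y] a]
      by simp
    then show False using ne by simp
  qed
  ultimately show ?thesis using centre_values[OF x a centres_pts[OF y]] by auto
qed

section \<open>The body is a cube in suitable lattice coordinates\<close>

lemma card_pts_ge: "3 ^ CARD('n) \<le> card pts"
proof -
  have "PiE UNIV (\<lambda>_. {0..<3}) \<subseteq> res3 ` pts"
  proof
    fix f :: "'n \<Rightarrow> int" assume f: "f \<in> PiE UNIV (\<lambda>_. {0..<3})"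
    let ?v = "(\<chi> i. of_int (f i)) :: real^'n"
    have v: "int_point ?v" by (simp add: int_point_def)
    then obtain p where p: "p \<in> pts" "cong3 p ?v" using all_residues by blast
    have "int_point p" using p(1) by (simp add: pts_def)
    then have "res3 p = f" using res3_eq_iff[OF _ v] p(2) res3_of_int_vec[OF f] by simp
    then show "f \<in> res3 ` pts" using p(1) by blast
  qed
  from card_mono[OF _ this] have "card (PiE (UNIV::'n set) (\<lambda>_. {0..<3::int})) \<le> card (res3 ` pts)"
    using finite_pts by blast
  then show ?thesis using card_image_le[OF finite_pts, of res3] card_residues[where 'n='n] by linarith
qed

theorem is_cube:
  obtains f a where "dual_lattice_bases f a" "K = {x. \<forall>i. \<bar>a i \<bullet> x\<bar> \<le> 1}"
proof -
  obtain B where B: "B \<subseteq> centres" "independent B" "centres \<subseteq> span B"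
    using maximal_independent_subset[of centres] by metis
  define \<alpha> where "\<alpha> b = (SOME a. a \<in> normals b)" for b
  have \<alpha>: "\<alpha> b \<in> normals b" if "b \<in> centres" for b
    using normals_nonempty[of b] that unfolding \<alpha>_def centres_def by (metis (no_types, lifting) mem_Collect_eq someI)
  have finB: "finite B" using B(2) independent_imp_finite by blast
  \<comment> \<open>If neither \<open>x\<close> nor \<open>-x\<close> were in \<open>B\<close>, a
    normal of \<open>x\<close> would vanish on \<open>B\<close>, hence on its span, which contains
    \<open>x\<close>.\<close>
  have cover: "x \<in> B \<or> - x \<in> B" if x: "x \<in> centres" for x
  proof (rule ccontr)
    assume n: "\<not> ?thesis"
    have base: "\<alpha> x \<bullet> b = 0" if "b \<in> B" for b
    proof (rule centres_orthogonal[OF x _ \<alpha>[OF x]])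
      show "b \<in> centres" using that B by blast
      show "b \<noteq> x" "b \<noteq> - x" using n that by auto
    qed
    have "\<alpha> x \<bullet> y = 0" if "y \<in> span B" for y
      using that by (induction rule: span_induct) (auto intro!: subspaceI simp: inner_add_right base)
    then have "\<alpha> x \<bullet> x = 0" using B(3) x by blast
    then show False using \<alpha>[OF x] by (simp add: normals_def)
  qed
  have dual: "\<alpha> b \<bullet> c = (if b = c then 1 else 0)" if bc: "b \<in> B" "c \<in> B" for b c
  proof (cases "b = c")
    case True then show ?thesis using \<alpha> B(1) bc by (auto simp: normals_def)
  next
    case False
    have "c \<noteq> - b"
    proof
      assume "c = - b"
      then have "b \<in> span (B - {b})"
        using span_neg[OF span_base, of c "B - {b}"] bc False by auto
      then show False using B(2) bc by (auto simp: dependent_def)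
    qed
    then show ?thesis
      using centres_orthogonal[of b c "\<alpha> b"] \<alpha> B(1) bc False by auto
  qed
  \<comment> \<open>Coordinates of lattice points with respect to one normal per basis vector.
    Centres separate points, so \<open>\<Phi>\<close> is injective; comparing
    \<open>3 ^ CARD('n)\<close> with \<open>3 ^ card B\<close> then makes \<open>B\<close> a basis
    and \<open>\<Phi>\<close> a bijection onto all vectors with entries -1, 0, 1.\<close>
  define \<Phi> where "\<Phi> p = restrict (\<lambda>b. \<alpha> b \<bullet> p) B" for p
  let ?S = "PiE B (\<lambda>_. {-1, 0, 1::real})"
  have \<Phi>in: "\<Phi> ` pts \<subseteq> ?S"
    using centre_values \<alpha> B(1) by (fastforce simp: \<Phi>_def)
  have "inj_on \<Phi> pts"
  proof (rule inj_onI, rule ccontr)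
    fix p p' assume p: "p \<in> pts" "p' \<in> pts" "\<Phi> p = \<Phi> p'" "p \<noteq> p'"
    have eq: "\<alpha> b \<bullet> p = \<alpha> b \<bullet> p'" if "b \<in> B" for b
      using fun_cong[OF p(3), of b] that by (simp add: \<Phi>_def)
    obtain x where x: "x \<in> centres"
      "\<And>a. a \<in> normals x \<Longrightarrow> a \<bullet> p - a \<bullet> p' = 1 \<or> a \<bullet> p = 1 \<and> a \<bullet> p' = -1"
      using separating_centre[OF p(1,2,4)] by blast
    from cover[OF x(1)] show False
    proof
      assume "x \<in> B" then show False using x(2)[OF \<alpha>[OF x(1)]] eq[of x] by auto
    next
      assume m: "- x \<in> B"
      have "- \<alpha> (- x) \<in> normals x" using \<alpha>[OF centres_minus[OF x(1)]] normals_minus by blast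
      from x(2)[OF this] show False using eq[OF m] by auto
    qed
  qed
  then have "card pts = card (\<Phi> ` pts)" by (simp add: card_image)
  also have "\<dots> \<le> card ?S" by (rule card_mono[OF _ \<Phi>in]) (simp add: finB finite_PiE)
  finally have le1: "card pts \<le> card ?S" .
  have cS: "card ?S = 3 ^ card B" by (simp add: card_PiE finB numeral_3_eq_3)
  have "card B \<le> CARD('n)" using independent_bound[OF B(2)] by simp
  moreover have "(3::nat) ^ CARD('n) \<le> 3 ^ card B" using le1 cS card_pts_ge by linarith
  then have "CARD('n) \<le> card B" by simp
  ultimately have cB: "card B = CARD('n)" by simp
  have "\<Phi> ` pts = ?S"
    by (rule card_subset_eq[OF _ \<Phi>in])
      (use finB card_pts_ge le1 cS cB \<open>card pts = card (\<Phi> ` pts)\<close> in \<open>auto simp: finite_PiE\<close>)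
  have spanB: "x \<in> span B" for x
    using card_ge_dim_independent[of B UNIV] B(2) cB by auto
  obtain f where f: "bij_betw f (UNIV::'n set) B"
    using finite_same_card_bij[of "UNIV::'n set" B] finB cB by auto
  define a where "a i = \<alpha> (f i)" for i
  have fB: "f i \<in> B" for i using f by (auto simp: bij_betw_def)
  have finj: "f i = f j \<longleftrightarrow> i = j" for i j using f by (auto simp: bij_betw_def inj_def)
  have af: "a i \<bullet> f j = (if i = j then 1 else 0)" for i j
    using dual[OF fB fB] finj by (simp add: a_def)
  have expand: "(\<Sum>i\<in>UNIV. (a i \<bullet> x) *\<^sub>R f i) = x" for x
  proof -
    have base: "(\<Sum>i\<in>UNIV. (a i \<bullet> b) *\<^sub>R f i) = b" if bB: "b \<in> B" for b
    proof -
      obtain j where j: "b = f j" using bB f unfolding bij_betw_def by blast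
      have "(\<Sum>i\<in>UNIV. (a i \<bullet> f j) *\<^sub>R f i) = (\<Sum>i\<in>UNIV. if i = j then f i else 0)"
        by (rule sum.cong) (auto simp: af)
      then show ?thesis using j by simp
    qed
    show ?thesis using spanB[of x]
      by (induction rule: span_induct)
        (auto intro!: subspaceI simp: base inner_add_right scaleR_add_left sum.distrib
            simp flip: scaleR_scaleR scaleR_sum_right)
  qed
  have aN: "a i \<in> normals (f i)" for i
    using \<alpha> fB B(1) by (auto simp: a_def)
  have vertex: "(\<Sum>i\<in>UNIV. k i *\<^sub>R f i) \<in> K" if k: "\<And>i. k i \<in> {-1,0,1}" for k
  proof -
    have "restrict (k \<circ> the_inv f) B \<in> ?S" using k by auto
    then obtain p where p: "p \<in> pts" "restrict (k \<circ> the_inv f) B = \<Phi> p"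
      using \<open>\<Phi> ` pts = ?S\<close> by blast
    have "a i \<bullet> p = k i" for i
      using fun_cong[OF p(2), of "f i"] fB[of i] f
      by (simp add: \<Phi>_def a_def the_inv_f_f bij_betw_def)
    then have "(\<Sum>i\<in>UNIV. k i *\<^sub>R f i) = p" using expand[of p] by simp
    then show ?thesis using p(1) pts_in by simp
  qed
  \<comment> \<open>\<open>S\<close> collects the coordinates that may be arbitrary in [-1, 1]. A
    new one is interpolated between its extreme values -1 and 1, starting from the lattice points of
    \<open>vertex\<close>.\<close>
  have cube: "(\<Sum>i\<in>UNIV. t i *\<^sub>R f i) \<in> K"
    if "finite S" "\<And>i. i \<in> S \<Longrightarrow> \<bar>t i\<bar> \<le> 1" "\<And>i. i \<notin> S \<Longrightarrow> t i \<in> {-1,0,1}" for S t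
    using that
  proof (induction S arbitrary: t rule: finite_induct)
    case empty then show ?case using vertex by simp
  next
    case (insert j S)
    let ?v = "\<lambda>c. (\<Sum>i\<in>UNIV. (t(j := c)) i *\<^sub>R f i)"
    have v: "?v c \<in> K" if "c \<in> {-1, 1}" for c
      by (rule insert.IH) (use insert that in auto)
    have split: "?v c = (\<Sum>i\<in>UNIV - {j}. t i *\<^sub>R f i) + c *\<^sub>R f j" for c
      by (subst sum.remove[of _ j]) auto
    have "(\<Sum>i\<in>UNIV. t i *\<^sub>R f i) = ?v (t j)" by simp
    also have "\<dots> = ((1 + t j) / 2) *\<^sub>R ?v 1 + ((1 - t j) / 2) *\<^sub>R ?v (-1)"
      unfolding split by (simp add: vec_eq_iff field_simps)
    also have "\<dots> \<in> K"
      by (rule convexD[OF convex v v]) (use insert.prems(1)[of j] in \<open>auto simp: abs_le_iff field_simps\<close>)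
    finally show ?case .
  qed
  have Keq: "K = {x. \<forall>i. \<bar>a i \<bullet> x\<bar> \<le> 1}"
  proof (intro set_eqI iffI)
    fix x assume "x \<in> K"
    then show "x \<in> {x. \<forall>i. \<bar>a i \<bullet> x\<bar> \<le> 1}" using normals_abs_le[OF aN] by blast
  next
    fix x assume "x \<in> {x. \<forall>i. \<bar>a i \<bullet> x\<bar> \<le> 1}"
    then show "x \<in> K" using cube[of UNIV "\<lambda>i. a i \<bullet> x"] expand[of x] by simp
  qed
  have fint: "int_point (f i)" for i
    using fB B(1) centres_pts by (auto simp: pts_def)
  have integral: "a i \<bullet> v \<in> \<int>" if v: "int_point v" for i v
  proof -
    \<comment> \<open>Rounding leaves a remainder with coordinates at most 1/2 in absolute value. So
      \<open>2 *\<^sub>R r\<close> is in \<open>K\<close>, and \<open>r\<close> is an interior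
      lattice point, that is, 0.\<close>
    define r where "r = v - (\<Sum>j\<in>UNIV. of_int (round (a j \<bullet> v)) *\<^sub>R f j)"
    have "a i \<bullet> (\<Sum>j\<in>UNIV. c j *\<^sub>R f j) = c i" for i c
    proof -
      have "a i \<bullet> (\<Sum>j\<in>UNIV. c j *\<^sub>R f j) = (\<Sum>j\<in>UNIV. if i = j then c j else 0)"
        unfolding inner_sum_right by (rule sum.cong) (auto simp: af)
      then show ?thesis by simp
    qed
    then have ar: "a i \<bullet> r = a i \<bullet> v - of_int (round (a i \<bullet> v))" for i
      by (simp add: r_def inner_diff_right)
    have "\<bar>a i \<bullet> r\<bar> \<le> 1/2" for i
      unfolding ar using of_int_round_abs_le[of "a i \<bullet> v"] by (simp add: abs_minus_commute)
    then have "\<bar>a i \<bullet> (2 *\<^sub>R r)\<bar> \<le> 1" for i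
      by (simp add: abs_mult mult.commute[of 2])
    then have "2 *\<^sub>R r \<in> K" unfolding Keq by blast
    then have "r \<in> interior K" using scale_interior[of "2 *\<^sub>R r" "1/2"] by simp
    moreover have "int_point r"
      unfolding r_def by (intro int_point_diff v int_point_sum int_point_scale fint)
    ultimately have "r = 0" by (rule interior_trivial)
    then have "a i \<bullet> v = of_int (round (a i \<bullet> v))" using ar[of i] by simp
    then show ?thesis by (metis Ints_of_int)
  qed
  have "dual_lattice_bases f a"
    unfolding dual_lattice_bases_def using fint integral af expand by blast
  then show ?thesis using that Keq by blast
qed

end

subsection \<open>Bodies with a nonzero interior lattice point\<close>

text \<open>A generic functional vanishing on \<open>w\<close>; applied to differences of lattice
  points it tells the lines parallel to \<open>w\<close> apart and orders them. A new vector on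
  which it vanishes is handled by a perturbation along its component \<open>s'\<close> orthogonal to
  \<open>w\<close>, with a factor avoiding finitely many values.\<close>

lemma separating_normal:
  fixes w :: "'a::euclidean_space"
  assumes "finite S" "w \<noteq> 0"
  shows "\<exists>g. g \<bullet> w = 0 \<and> (\<forall>s\<in>S. g \<bullet> s = 0 \<longrightarrow> (\<exists>t. s = t *\<^sub>R w))"
  using assms(1)
proof (induction S rule: finite_induct)
  case empty
  show ?case by (rule exI[of _ 0]) simp
next
  case (insert s S)
  then obtain g where g: "g \<bullet> w = 0" "\<forall>s\<in>S. g \<bullet> s = 0 \<longrightarrow> (\<exists>t. s = t *\<^sub>R w)" by blast
  show ?case
  proof (cases "g \<bullet> s = 0 \<and> (\<forall>t. s \<noteq> t *\<^sub>R w)")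
    case False
    then show ?thesis using g by blast
  next
    case True
    define s' where "s' = s - ((s \<bullet> w) / (w \<bullet> w)) *\<^sub>R w"
    have s'w: "s' \<bullet> w = 0" using \<open>w \<noteq> 0\<close> by (simp add: s'_def inner_diff_left)
    have "s' \<noteq> 0" using True by (auto simp: s'_def)
    have "s' \<bullet> s = s' \<bullet> s'"
      using s'w by (simp add: s'_def inner_diff_right inner_commute)
    then have s's: "s' \<bullet> s \<noteq> 0" using \<open>s' \<noteq> 0\<close> by simp
    obtain e :: real where e: "e \<notin> insert 0 ((\<lambda>u. - (g \<bullet> u) / (s' \<bullet> u)) ` S)"
      using ex_new_if_finite[OF infinite_UNIV_char_0, of "insert 0 ((\<lambda>u. - (g \<bullet> u) / (s' \<bullet> u)) ` S)"]
        insert.hyps(1) by auto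
    have "\<exists>t. u = t *\<^sub>R w" if u: "u \<in> S" "(g + e *\<^sub>R s') \<bullet> u = 0" for u
    proof (cases "g \<bullet> u = 0")
      case True then show ?thesis using g u(1) by blast
    next
      case False
      have eq: "g \<bullet> u + e * (s' \<bullet> u) = 0" using u(2) by (simp add: inner_add_left)
      then have "s' \<bullet> u \<noteq> 0" using False by auto
      then have "e = - (g \<bullet> u) / (s' \<bullet> u)" using eq by (simp add: field_simps)
      then show ?thesis using e u(1) by blast
    qed
    moreover have "(g + e *\<^sub>R s') \<bullet> s \<noteq> 0" using True e s's by (simp add: inner_add_left)
    moreover have "(g + e *\<^sub>R s') \<bullet> w = 0" using g(1) s'w by (simp add: inner_add_left)
    ultimately show ?thesis by (intro exI[of _ "g + e *\<^sub>R s'"]) auto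
  qed
qed

text \<open>In the application \<open>X\<close> indexes the parallel lines of a residue class, \<open>n\<close> counts the
  points on them and \<open>i\<close> counts interior points on lines. Deleting always the extreme line with fewer points
  charges the deleted points to interior points with a new, larger difference.\<close>

lemma charge_extreme_lines:
  fixes X :: "real set" and n i :: "real \<Rightarrow> nat"
  assumes "finite X" "X \<noteq> {}" and l: "l \<ge> 2" and n: "\<And>s. s \<in> X \<Longrightarrow> n s \<le> 2 * l + 1"
    and i: "\<And>s t. s \<in> X \<Longrightarrow> t \<in> X \<Longrightarrow> t < s \<Longrightarrow> (n s + n t + 2 * l - 3) div 3 \<le> i (s - t)"
  shows "\<exists>D. finite D \<and> D \<subseteq> {0<..Max X - Min X} \<and> sum n X \<le> 2 * sum i D + 2 * l + 1 \<and>
    (card X \<ge> 2 \<longrightarrow> sum n X < 2 * sum i D + 2 * l + 1)"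
  using assms(1,2) n i
proof (induction "card X" arbitrary: X)
  case 0 then show ?case by simp
next
  case (Suc c)
  have fin: "finite X" by fact
  show ?case
  proof (cases "card X = 1")
    case True
    then obtain s where "X = {s}" using card_1_singletonE by blast
    then show ?thesis using Suc.prems(3)[of s] by (intro exI[of _ "{}"]) auto
  next
    case False
    define a b where "a = Min X" and "b = Max X"
    have ab: "a \<in> X" "b \<in> X" "\<And>x. x \<in> X \<Longrightarrow> a \<le> x \<and> x \<le> b"
      using fin Suc.prems(2) by (auto simp: a_def b_def)
    have "a \<noteq> b"
    proof
      assume "a = b"
      then have "X = {a}" using ab by force
      then show False using False by simp
    qed
    then have less: "a < b" using ab(1) ab(3)[of a] by simp
    \<comment> \<open>The cost of deleting the line with fewer points \<open>x\<close>. Interior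
      points count twice because each will come with its negative.\<close>
    have n1: "x \<le> 2 * ((x + y + 2 * l - 3) div 3)" if "x \<le> y" "y \<le> 2 * l + 1" for x y
    proof -
      define q where "q = (x + y + 2 * l - 3) div 3"
      have "x + y + 2 * l - 3 \<le> 3 * q + 2" by (simp add: q_def)
      then have "x + y + 2 * l \<le> 3 * q + 5" by simp
      then have "x \<le> 2 * q" using l that by (cases "q \<ge> 2") auto
      then show ?thesis by (simp add: q_def)
    qed
    \<comment> \<open>Provides strictness when two lines are left: twice the bound on the quotient
      together with \<open>x + y \<le> 4 * l + 2\<close> gives \<open>x + y \<le> 2 * q + 4\<close>,
      and \<open>l \<ge> 2\<close>.\<close>
    have n2: "x + y < 2 * ((x + y + 2 * l - 3) div 3) + 2 * l + 1" if "x \<le> y" "y \<le> 2 * l + 1" for x y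
    proof -
      define q where "q = (x + y + 2 * l - 3) div 3"
      have "x + y + 2 * l - 3 \<le> 3 * q + 2" by (simp add: q_def)
      then have "x + y + 2 * l \<le> 3 * q + 5" by simp
      then have "x + y < 2 * q + 2 * l + 1" using l that by linarith
      then show ?thesis by (simp add: q_def)
    qed
    obtain e f where ef: "{e, f} = {a, b}" "e \<noteq> f" "n e \<le> n f"
      using less by (cases "n a \<le> n b") (force, metis insert_commute nat_le_linear order_less_irrefl)
    have efX: "e \<in> X" "f \<in> X" using ef(1) ab by (auto simp: doubleton_eq_iff)
    define X' where "X' = X - {e}"
    have X': "finite X'" "f \<in> X'" "card X' = c"
      using fin efX ef(2) Suc.hyps(2) by (auto simp: X'_def)
    have "\<exists>D. finite D \<and> D \<subseteq> {0<..Max X' - Min X'} \<and> sum n X' \<le> 2 * sum i D + 2 * l + 1 \<and>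
        (card X' \<ge> 2 \<longrightarrow> sum n X' < 2 * sum i D + 2 * l + 1)"
    proof (rule Suc.hyps(1))
      show "c = card X'" "finite X'" "X' \<noteq> {}" using X' by auto
      show "n s \<le> 2 * l + 1" if "s \<in> X'" for s
        using Suc.prems(3) that by (simp add: X'_def)
      show "(n s + n t + 2 * l - 3) div 3 \<le> i (s - t)" if "s \<in> X'" "t \<in> X'" "t < s" for s t
        using Suc.prems(4)[of s t] that by (simp add: X'_def)
    qed
    then obtain D where D: "finite D" "D \<subseteq> {0<..Max X' - Min X'}" "sum n X' \<le> 2 * sum i D + 2 * l + 1"
        "card X' \<ge> 2 \<Longrightarrow> sum n X' < 2 * sum i D + 2 * l + 1"
      by blast
    have smaller: "Max X' - Min X' < b - a"
    proof -
      have "Max X' \<in> X'" "Min X' \<in> X'" using X' Max_in Min_in by blast+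
      then show ?thesis
        using ab(3)[of "Max X'"] ab(3)[of "Min X'"] ef(1) by (auto simp: X'_def doubleton_eq_iff)
    qed
    then have notin: "b - a \<notin> D" using D(2) by auto
    have ineq: "(n e + n f + 2 * l - 3) div 3 \<le> i (b - a)"
      using Suc.prems(4)[OF ab(2,1) less] ef(1) by (auto simp: doubleton_eq_iff add.commute)
    have "sum n X = n e + sum n X'"
      using fin efX(1) by (simp add: X'_def sum.remove)
    moreover have sD: "sum i (insert (b - a) D) = i (b - a) + sum i D"
      using D(1) notin by simp
    have nf: "n f \<le> 2 * l + 1" using Suc.prems(3) efX by blast
    have "sum n X < 2 * sum i (insert (b - a) D) + 2 * l + 1"
    proof (cases "card X' \<ge> 2")
      case True
      then show ?thesis using D(4) n1[OF ef(3) nf] ineq sD \<open>sum n X = n e + sum n X'\<close> by linarith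
    next
      case False
      then have "card X' = 1" using X' by (metis One_nat_def Suc_leI card_gt_0_iff empty_iff le_antisym
        not_less_eq_eq numeral_2_eq_2)
      then have "X' = {f}" using X'(2) card_1_singletonE by blast
      then show ?thesis using n2[OF ef(3) nf] ineq sD \<open>sum n X = n e + sum n X'\<close> by simp
    qed
    moreover have "insert (b - a) D \<subseteq> {0<..Max X - Min X}"
      using D(2) smaller less by (auto simp: a_def b_def)
    ultimately show ?thesis
      using D(1) by (intro exI[of _ "insert (b - a) D"]) auto
  qed
qed

text \<open>\<open>l\<close> is the first multiple of the primitive vector \<open>w\<close> that
  leaves the interior; \<open>l \<ge> 2\<close> says that \<open>w\<close> itself is
  interior.\<close>

locale long_body = symmetric_body K for K :: "(real^'n) set" +
  fixes w :: "real^'n" and l :: nat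
  assumes w_int: "int_point w"
    and primitive: "int_point (t *\<^sub>R w) \<Longrightarrow> t \<in> \<int>"
    and l_ge: "l \<ge> 2"
    and multiples_interior: "of_int k *\<^sub>R w \<in> interior K \<longleftrightarrow> \<bar>k\<bar> < int l"
begin

lemma w_nonzero: "w \<noteq> 0"
proof
  assume "w = 0"
  then have "(1/2::real) \<in> \<int>" using primitive[of "1/2"] by simp
  then show False by auto
qed

lemma multiples_inj: "inj (\<lambda>k::int. x + of_int k *\<^sub>R w)"
  using w_nonzero by (auto simp: inj_def)

lemma central_ipts: "(\<lambda>k. of_int k *\<^sub>R w) ` {- (int l - 1)..int l - 1} \<subseteq> ipts"
proof
  fix x assume "x \<in> (\<lambda>k. of_int k *\<^sub>R w) ` {- (int l - 1)..int l - 1}"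
  then obtain k :: int where "x = of_int k *\<^sub>R w" "k \<in> {- (int l - 1)..int l - 1}" by blast
  moreover from this have "\<bar>k\<bar> < int l" by auto
  ultimately show "x \<in> ipts" using multiples_interior int_point_scale[OF w_int] by (simp add: ipts_def)
qed

lemma card_central: "card ((\<lambda>k::int. of_int k *\<^sub>R w) ` {- (int l - 1)..int l - 1}) = 2 * l - 1"
proof -
  have "inj (\<lambda>k::int. of_int k *\<^sub>R w)" using multiples_inj[of 0] by simp
  then have "inj_on (\<lambda>k::int. of_int k *\<^sub>R w) {- (int l - 1)..int l - 1}"
    using inj_on_subset by blast
  from card_image[OF this] show ?thesis using l_ge by simp
qed

text \<open>Symmetrisation: the midpoint of the far end and of \<open>-x\<close> is
  \<open>k / 2\<close> times \<open>w\<close>. If \<open>k\<close> exceeded \<open>2 * l\<close>,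
  the point \<open>l\<close> times \<open>w\<close> would be interior.\<close>

lemma segment_bound:
  assumes "x \<in> K" "x + of_int k *\<^sub>R w \<in> K"
  shows "k \<le> 2 * int l"
proof (rule ccontr)
  assume k: "\<not> ?thesis"
  then have k0: "real_of_int k > 2 * real l" by linarith
  have "(1/2) *\<^sub>R (x + of_int k *\<^sub>R w) + (1/2) *\<^sub>R (- x) \<in> K"
    using convexD[OF convex assms(2) symmetric[OF assms(1)]] by simp
  then have "(of_int k / 2) *\<^sub>R w \<in> K" by (simp add: algebra_simps)
  then have "(2 * real l / of_int k) *\<^sub>R ((of_int k / 2) *\<^sub>R w) \<in> interior K"
    by (rule scale_interior) (use k0 in auto)
  then have "of_int (int l) *\<^sub>R w \<in> interior K" using k0 by simp
  then show False using multiples_interior[of "int l"] by simp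
qed

lemma convex_segment:
  assumes "x + of_int a *\<^sub>R w \<in> K" "x + of_int b *\<^sub>R w \<in> K" "a \<le> c" "c \<le> b"
  shows "x + of_int c *\<^sub>R w \<in> K"
proof (cases "a = b")
  case True then show ?thesis using assms by simp
next
  case False
  define t where "t = (of_int c - of_int a) / (of_int b - of_int a :: real)"
  have d: "of_int b - of_int a > (0::real)" using False assms(3,4) by linarith
  then have t: "0 \<le> t" "t \<le> 1" "t * (of_int b - of_int a) = of_int c - of_int a"
    using assms(3,4) by (auto simp: t_def)
  have tc: "of_int c = (1 - t) * of_int a + t * of_int b" using t(3) by (simp add: algebra_simps)
  have "(1 - t) *\<^sub>R (x + of_int a *\<^sub>R w) + t *\<^sub>R (x + of_int b *\<^sub>R w) \<in> K"
    by (rule convexD[OF convex assms(1,2)]) (use t in auto)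
  moreover have "(1 - t) *\<^sub>R (x + of_int a *\<^sub>R w) + t *\<^sub>R (x + of_int b *\<^sub>R w) = x + of_int c *\<^sub>R w"
    unfolding tc by (simp add: algebra_simps)
  ultimately show ?thesis by simp
qed

text \<open>\<open>T\<close> is the part of \<open>K\<close> in a residue class modulo the lattice generated by \<open>3\<int>\<^sup>n\<close> and \<open>w\<close>.\<close>

lemma residue_class_bound:
  assumes T: "T \<subseteq> pts"
    and closed: "\<And>x k. x \<in> T \<Longrightarrow> x + of_int k *\<^sub>R w \<in> pts \<Longrightarrow> x + of_int k *\<^sub>R w \<in> T"
    and congr: "\<And>x y. x \<in> T \<Longrightarrow> y \<in> T \<Longrightarrow> \<exists>k. cong3 x (y + of_int k *\<^sub>R w)"
  shows "card T \<le> card ipts + 2"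
    and "card T = card ipts + 2 \<Longrightarrow> card ipts = 2 * l - 1 \<and> (\<exists>m. (\<lambda>k. m + of_int k *\<^sub>R w) ` {- int l..int l} = T)"
proof -
  have finT: "finite T" using T finite_pts finite_subset by blast
  obtain g where g: "g \<bullet> w = 0"
    "\<forall>s\<in>(\<lambda>(x, y). x - y) ` (pts \<times> pts). g \<bullet> s = 0 \<longrightarrow> (\<exists>t. s = t *\<^sub>R w)"
    using separating_normal[of "(\<lambda>(x, y). x - y) ` (pts \<times> pts)" w] finite_pts w_nonzero by blast
  \<comment> \<open>Equal values of \<open>g\<close> mean a common line parallel to
    \<open>w\<close>; primitivity makes the step between the points an integer multiple of
    \<open>w\<close>.\<close>
  have line: "\<exists>k::int. x = y + of_int k *\<^sub>R w" if xy: "x \<in> pts" "y \<in> pts" "g \<bullet> x = g \<bullet> y" for x y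
  proof -
    have "g \<bullet> (x - y) = 0" using xy by (simp add: inner_diff_right)
    then obtain t where t: "x - y = t *\<^sub>R w" using g(2) xy by force
    have "int_point (x - y)" using xy by (auto simp: pts_def intro: int_point_diff)
    then have "t \<in> \<int>" using primitive t by simp
    then obtain k where "t = of_int k" by (auto elim: Ints_cases)
    then have "x = y + of_int k *\<^sub>R w" using t by (simp add: algebra_simps)
    then show ?thesis by blast
  qed
  define fib where "fib s = {x \<in> T. g \<bullet> x = s}" for s
  \<comment> \<open>By convexity and \<open>closed\<close>, \<open>T\<close> meets a line in a run
    of consecutive points, at most \<open>2 * l + 1\<close> of them by
    \<open>segment_bound\<close>.\<close>
  have fib: "\<exists>x0. fib s = (\<lambda>k. x0 + of_int k *\<^sub>R w) ` {0..<int (card (fib s))}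
      \<and> 1 \<le> card (fib s) \<and> card (fib s) \<le> 2 * l + 1" if s: "s \<in> (\<bullet>) g ` T" for s
  proof -
    obtain x1 where x1: "x1 \<in> fib s" using s by (auto simp: fib_def)
    define J where "J = {k::int. x1 + of_int k *\<^sub>R w \<in> fib s}"
    have img: "(\<lambda>k. x1 + of_int k *\<^sub>R w) ` J = fib s"
    proof (intro equalityI subsetI)
      fix x assume x: "x \<in> fib s"
      then obtain k where "x = x1 + of_int k *\<^sub>R w"
        using line[of x x1] x1 T by (auto simp: fib_def)
      then show "x \<in> (\<lambda>k. x1 + of_int k *\<^sub>R w) ` J" using x by (auto simp: J_def)
    qed (auto simp: J_def)
    have injJ: "inj_on (\<lambda>k. x1 + of_int k *\<^sub>R w) J"
      using multiples_inj inj_on_subset by blast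
    have finJ: "finite J"
      using finite_imageD[OF _ injJ] img finT by (simp add: fib_def)
    have "0 \<in> J" using x1 by (simp add: J_def)
    then have "J \<noteq> {}" by blast
    define p q where "p = Min J" and "q = Max J"
    have pq: "p \<in> J" "q \<in> J" "\<And>k. k \<in> J \<Longrightarrow> p \<le> k \<and> k \<le> q"
      using finJ \<open>J \<noteq> {}\<close> by (auto simp: p_def q_def)
    have "J = {p..q}"
    proof (intro equalityI subsetI)
      fix k assume k: "k \<in> {p..q}"
      have "x1 + of_int k *\<^sub>R w \<in> K"
        by (rule convex_segment[of _ p q]) (use pq(1,2) k T in \<open>auto simp: J_def fib_def pts_def\<close>)
      moreover have "int_point x1" using x1 T by (auto simp: fib_def pts_def)
      ultimately have "x1 + of_int k *\<^sub>R w \<in> pts"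
        using w_int by (auto simp: pts_def intro!: int_point_add int_point_scale)
      then have "x1 + of_int k *\<^sub>R w \<in> T" using closed x1 by (auto simp: fib_def)
      then show "k \<in> J" using x1 g(1) by (simp add: J_def fib_def inner_add_right)
    qed (use pq(3) in auto)
    then have card: "int (card (fib s)) = q - p + 1"
      using card_image[OF injJ] img pq(3)[OF pq(1)] by simp
    define x0 where "x0 = x1 + of_int p *\<^sub>R w"
    have "fib s = (\<lambda>k. x0 + of_int k *\<^sub>R w) ` {0..<q - p + 1}"
    proof -
      have "{p..q} = (\<lambda>k. k + p) ` {0..<q - p + 1}"
        by (auto intro!: image_eqI[of _ _ "_ - p"])
      then have "fib s = (\<lambda>k. x1 + of_int k *\<^sub>R w) ` (\<lambda>k. k + p) ` {0..<q - p + 1}"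
        using img \<open>J = {p..q}\<close> by simp
      moreover have "x1 + of_int (k + p) *\<^sub>R w = x0 + of_int k *\<^sub>R w" for k
        by (simp add: x0_def algebra_simps)
      ultimately show ?thesis by (simp only: image_image)
    qed
    moreover have "q - p \<le> 2 * int l"
    proof (rule segment_bound)
      show "x0 \<in> K" using pq(1) T by (auto simp: J_def x0_def fib_def pts_def)
      have "x0 + of_int (q - p) *\<^sub>R w = x1 + of_int q *\<^sub>R w"
        by (simp add: x0_def algebra_simps)
      then show "x0 + of_int (q - p) *\<^sub>R w \<in> K"
        using pq(2) T by (auto simp: J_def fib_def pts_def)
    qed
    moreover have "p \<le> q" using pq(3)[OF pq(1)] by simp
    ultimately show ?thesis using card by (intro exI[of _ x0]) auto
  qed
  define ifib where "ifib d = {z \<in> ipts. g \<bullet> z = d / 3}" for d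
  \<comment> \<open>Differences of points on the two lines plus interior multiples of
    \<open>w\<close> realise every coefficient of \<open>w\<close> from \<open>-(b + l - 2)\<close>
    to \<open>a + l - 2\<close>. These are \<open>a + b + 2 * l - 3\<close> consecutive integers,
    and one class modulo 3 among them yields lattice points after division by 3.\<close>
  have cross: "(card (fib s) + card (fib t) + 2 * l - 3) div 3 \<le> card (ifib (s - t))"
    if st: "s \<in> (\<bullet>) g ` T" "t \<in> (\<bullet>) g ` T" for s t
  proof -
    define a b where "a = int (card (fib s))" and "b = int (card (fib t))"
    obtain x0 where x0: "fib s = (\<lambda>k. x0 + of_int k *\<^sub>R w) ` {0..<a}" "1 \<le> a"
      using fib[OF st(1)] by (auto simp: a_def)
    obtain y0 where y0: "fib t = (\<lambda>k. y0 + of_int k *\<^sub>R w) ` {0..<b}" "1 \<le> b"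
      using fib[OF st(2)] by (auto simp: b_def)
    have x: "x0 + of_int k *\<^sub>R w \<in> fib s" if "0 \<le> k" "k < a" for k using x0(1) that by auto
    have y: "y0 + of_int k *\<^sub>R w \<in> fib t" if "0 \<le> k" "k < b" for k using y0(1) that by auto
    have x00: "x0 \<in> fib s" and y00: "y0 \<in> fib t" using x[of 0] y[of 0] x0(2) y0(2) by auto
    obtain c where c: "cong3 x0 (y0 + of_int c *\<^sub>R w)"
      using congr x00 y00 by (auto simp: fib_def)
    define z0 where "z0 = (1/3) *\<^sub>R (x0 - (y0 + of_int c *\<^sub>R w))"
    have z0: "int_point z0" using c by (simp add: cong3_def z0_def)
    have eq: "z0 + of_int j *\<^sub>R w = (1/3) *\<^sub>R (x0 - y0 + of_int (3 * j - c) *\<^sub>R w)" for j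
      by (simp add: z0_def algebra_simps)
    \<comment> \<open>Bounds for \<open>3 * j\<close> and \<open>-3 * j\<close>: membership of
      \<open>j\<close> in \<open>J\<close> says that the coefficient \<open>3 * j - c\<close> lies
      in the realisable range.\<close>
    define p q where "p = a + int l - 2 + c" and "q = b + int l - 2 - c"
    define J where "J = {- (q div 3)..p div 3}"
    have "z0 + of_int j *\<^sub>R w \<in> ifib (s - t)" if j: "j \<in> J" for j
    proof -
      have j': "3 * j - c \<le> a + int l - 2" "- (3 * j - c) \<le> b + int l - 2"
        using j by (auto simp: J_def p_def q_def)
      \<comment> \<open>Greedy choice: one of the two segments absorbs as much of the coefficient as
        it can, and the rest is smaller than \<open>l\<close> in absolute value.\<close>
      obtain u v r where uvr: "3 * j - c = u - v + r" "0 \<le> u" "u < a" "0 \<le> v" "v < b" "\<bar>r\<bar> < int l"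
      proof (cases "3 * j - c \<ge> 0")
        case True
        define u where "u = min (a - 1) (3 * j - c)"
        show ?thesis by (rule that[of u 0 "3 * j - c - u"]) (use True j' x0(2) y0(2) l_ge in \<open>auto simp: u_def min_def\<close>)
      next
        case False
        define v where "v = min (b - 1) (- (3 * j - c))"
        show ?thesis by (rule that[of 0 v "3 * j - c + v"]) (use False j' x0(2) y0(2) l_ge in \<open>auto simp: v_def min_def\<close>)
      qed
      have "(1/3) *\<^sub>R ((x0 + of_int u *\<^sub>R w) + - (y0 + of_int v *\<^sub>R w) + of_int r *\<^sub>R w) \<in> interior K"
      proof (rule third_interior)
        show "x0 + of_int u *\<^sub>R w \<in> K" using x[OF uvr(2,3)] T by (auto simp: fib_def pts_def)
        show "- (y0 + of_int v *\<^sub>R w) \<in> K"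
          by (rule symmetric) (use y[OF uvr(4,5)] T in \<open>auto simp: fib_def pts_def\<close>)
        show "of_int r *\<^sub>R w \<in> interior K" using multiples_interior uvr(6) by simp
      qed
      moreover have "(1/3) *\<^sub>R ((x0 + of_int u *\<^sub>R w) + - (y0 + of_int v *\<^sub>R w) + of_int r *\<^sub>R w)
          = z0 + of_int j *\<^sub>R w"
        unfolding eq uvr(1) by (simp add: algebra_simps)
      ultimately have "z0 + of_int j *\<^sub>R w \<in> ipts"
        using z0 w_int by (auto simp: ipts_def intro!: int_point_add int_point_scale)
      moreover have "g \<bullet> (z0 + of_int j *\<^sub>R w) = (s - t) / 3"
        unfolding eq using x00 y00 g(1) by (simp add: fib_def inner_add_right inner_diff_right)
      ultimately show ?thesis by (simp add: ifib_def)
    qed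
    then have "(\<lambda>j. z0 + of_int j *\<^sub>R w) ` J \<subseteq> ifib (s - t)" by blast
    moreover have "finite (ifib (s - t))" using finite_ipts by (simp add: ifib_def)
    moreover have "inj_on (\<lambda>j. z0 + of_int j *\<^sub>R w) J"
      using multiples_inj inj_on_subset by blast
    ultimately have "card J \<le> card (ifib (s - t))" by (metis card_image card_mono)
    moreover have "int (card J) \<ge> (a + b + 2 * int l - 3) div 3"
    proof -
      have "(p + q + 1) div 3 \<le> p div 3 + q div 3 + 1" by presburger
      moreover have "p + q + 1 = a + b + 2 * int l - 3" by (simp add: p_def q_def)
      moreover have "int (card J) \<ge> p div 3 + q div 3 + 1" by (simp add: J_def)
      ultimately show ?thesis by simp
    qed
    moreover have "int ((card (fib s) + card (fib t) + 2 * l - 3) div 3) = (a + b + 2 * int l - 3) div 3"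
      using l_ge by (simp add: a_def b_def zdiv_int of_nat_diff)
    ultimately show ?thesis by linarith
  qed
  define P where "P = {z \<in> ipts. g \<bullet> z > 0}"
  \<comment> \<open>The interior lattice points where \<open>g\<close> is positive, their negatives,
    and the \<open>2 * l - 1\<close> multiples of \<open>w\<close> are disjoint.\<close>
  have ipts_ge: "card ipts \<ge> 2 * l - 1 + 2 * card P"
  proof -
    let ?C = "(\<lambda>k::int. of_int k *\<^sub>R w) ` {- (int l - 1)..int l - 1}"
    have finP: "finite P" using finite_ipts by (simp add: P_def)
    have "?C \<union> (P \<union> uminus ` P) \<subseteq> ipts"
      using central_ipts minus_ipts by (auto simp: P_def)
    then have "card (?C \<union> (P \<union> uminus ` P)) \<le> card ipts" using finite_ipts card_mono by blast
    moreover have "g \<bullet> z = 0" if "z \<in> ?C" for z using that g(1) by auto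
    then have "?C \<inter> (P \<union> uminus ` P) = {}" "P \<inter> uminus ` P = {}"
      by (fastforce simp: P_def)+
    then have "card (?C \<union> (P \<union> uminus ` P)) = card ?C + (card P + card (uminus ` P))"
      using finP by (simp add: card_Un_disjoint)
    moreover have "card (uminus ` P) = card P" by (rule card_image) simp
    ultimately show ?thesis using card_central by simp
  qed
  have cardT: "card T = (\<Sum>s\<in>(\<bullet>) g ` T. card (fib s))"
    using sum.image_gen[OF finT, of "\<lambda>_. 1::nat" "(\<bullet>) g"] by (simp add: fib_def)
  have main: "card T \<le> 2 * card P + 2 * l + 1 \<and> (card ((\<bullet>) g ` T) \<ge> 2 \<longrightarrow> card T < 2 * card P + 2 * l + 1)"
  proof (cases "T = {}")
    case True then show ?thesis by simp
  next
    case False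
    have "\<exists>D. finite D \<and> D \<subseteq> {0<..Max ((\<bullet>) g ` T) - Min ((\<bullet>) g ` T)} \<and>
        (\<Sum>s\<in>(\<bullet>) g ` T. card (fib s)) \<le> 2 * (\<Sum>d\<in>D. card (ifib d)) + 2 * l + 1 \<and>
        (card ((\<bullet>) g ` T) \<ge> 2 \<longrightarrow> (\<Sum>s\<in>(\<bullet>) g ` T. card (fib s)) < 2 * (\<Sum>d\<in>D. card (ifib d)) + 2 * l + 1)"
      by (rule charge_extreme_lines) (use finT False l_ge fib cross in auto)
    then obtain D where D: "finite D" "D \<subseteq> {0<..Max ((\<bullet>) g ` T) - Min ((\<bullet>) g ` T)}"
        "(\<Sum>s\<in>(\<bullet>) g ` T. card (fib s)) \<le> 2 * (\<Sum>d\<in>D. card (ifib d)) + 2 * l + 1"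
        "card ((\<bullet>) g ` T) \<ge> 2 \<longrightarrow> (\<Sum>s\<in>(\<bullet>) g ` T. card (fib s)) < 2 * (\<Sum>d\<in>D. card (ifib d)) + 2 * l + 1"
      by blast
    \<comment> \<open>Distinct differences give distinct values of \<open>g\<close>, so no interior
      point is charged twice; all \<open>d\<close> in \<open>D\<close> are positive, which places
      these points in \<open>P\<close>.\<close>
    have "(\<Sum>d\<in>D. card (ifib d)) = card (\<Union>d\<in>D. ifib d)"
      by (rule card_UN_disjoint[symmetric]) (use D(1) finite_ipts in \<open>auto simp: ifib_def\<close>)
    also have "\<dots> \<le> card P"
      by (rule card_mono) (use finite_ipts D(2) in \<open>auto simp: P_def ifib_def\<close>)
    finally show ?thesis using D(3,4) cardT by linarith
  qed
  show "card T \<le> card ipts + 2" using main ipts_ge l_ge by linarith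
  assume eq: "card T = card ipts + 2"
  \<comment> \<open>Two or more lines make the estimate strict, so equality leaves a single line,
    which must carry \<open>2 * l + 1\<close> points.\<close>
  have "\<not> card ((\<bullet>) g ` T) \<ge> 2" using main ipts_ge l_ge eq by linarith
  moreover have "T \<noteq> {}" using eq by auto
  then have "card ((\<bullet>) g ` T) > 0" using finT by (simp add: card_gt_0_iff)
  ultimately have "card ((\<bullet>) g ` T) = 1" by linarith
  then obtain s where s: "(\<bullet>) g ` T = {s}" using card_1_singletonE by blast
  then have Ts: "T = fib s" by (auto simp: fib_def)
  obtain x0 where x0: "fib s = (\<lambda>k. x0 + of_int k *\<^sub>R w) ` {0..<int (card (fib s))}" "card (fib s) \<le> 2 * l + 1"
    using fib[of s] s by auto
  have c1: "card (fib s) = 2 * l + 1" "card ipts = 2 * l - 1"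
    using x0(2) eq Ts ipts_ge l_ge by auto
  have "{0..<int (card (fib s))} = (\<lambda>k. k + int l) ` {- int l..int l}"
    unfolding c1 by (auto intro!: image_eqI[of _ _ "_ - int l"])
  then have "T = (\<lambda>k. x0 + of_int k *\<^sub>R w) ` (\<lambda>k. k + int l) ` {- int l..int l}"
    using x0(1) Ts by simp
  moreover have "x0 + of_int (k + int l) *\<^sub>R w = (x0 + of_int (int l) *\<^sub>R w) + of_int k *\<^sub>R w" for k
    by (simp add: algebra_simps)
  ultimately have "(\<lambda>k. (x0 + of_int (int l) *\<^sub>R w) + of_int k *\<^sub>R w) ` {- int l..int l} = T"
    by (simp only: image_image)
  then show "card ipts = 2 * l - 1 \<and> (\<exists>m. (\<lambda>k. m + of_int k *\<^sub>R w) ` {- int l..int l} = T)"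
    using c1(2) by blast
qed

end

section \<open>Existence of a primitive interior lattice point\<close>

context symmetric_body
begin

text \<open>A shortest nonzero interior lattice point is primitive, since a nonintegral multiple in
  the lattice would leave a shorter one after removing the integral part. Its multiples leave the
  interior because \<open>ipts\<close> is finite.\<close>

lemma exists_long_body:
  assumes "x \<in> ipts" "x \<noteq> 0"
  shows "\<exists>w l. long_body K w l"
proof -
  have fin: "finite (ipts - {0})" using finite_ipts by simp
  define w where "w = arg_min_on norm (ipts - {0})"
  have w: "w \<in> ipts - {0}" unfolding w_def
    by (rule arg_min_if_finite) (use fin assms in auto)
  have min: "norm w \<le> norm y" if "y \<in> ipts" "y \<noteq> 0" for y
    using arg_min_least[OF fin _, of y norm] that by (auto simp: w_def)
  have wi: "int_point w" "w \<in> interior K" "w \<noteq> 0" using w by (auto simp: ipts_def)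
  have prim: "t \<in> \<int>" if t: "int_point (t *\<^sub>R w)" for t
  proof (rule ccontr)
    assume n: "t \<notin> \<int>"
    define r where "r = frac t"
    have r: "0 < r" "r < 1" using n frac_gt_0_iff[of t] frac_lt_1[of t] by (auto simp: r_def)
    have "r *\<^sub>R w = t *\<^sub>R w - of_int \<lfloor>t\<rfloor> *\<^sub>R w" by (simp add: r_def frac_def algebra_simps)
    then have "int_point (r *\<^sub>R w)" using t wi(1) by (simp add: int_point_diff int_point_scale)
    moreover have "r *\<^sub>R w \<in> interior K"
      by (rule scale_interior) (use wi(2) interior_subset r in auto)
    ultimately have "r *\<^sub>R w \<in> ipts" by (simp add: ipts_def)
    from min[OF this] show False using r wi(3) by simp
  qed
  have "\<exists>k::nat. real k *\<^sub>R w \<notin> interior K"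
  proof (rule ccontr)
    assume "\<not> ?thesis"
    then have "range (\<lambda>k::nat. real k *\<^sub>R w) \<subseteq> ipts"
      using int_point_scale[OF wi(1), of "int _"] by (auto simp: ipts_def)
    moreover have "inj (\<lambda>k::nat. real k *\<^sub>R w)" using wi(3) by (auto simp: inj_def)
    ultimately show False using finite_ipts finite_imageD finite_subset infinite_UNIV_nat by blast
  qed
  define l where "l = (LEAST k::nat. real k *\<^sub>R w \<notin> interior K)"
  have l: "real l *\<^sub>R w \<notin> interior K"
    unfolding l_def using \<open>\<exists>k::nat. _\<close> by (rule LeastI_ex)
  have less: "real k *\<^sub>R w \<in> interior K" if "k < l" for k
    using not_less_Least that unfolding l_def by blast
  have nat: "real k *\<^sub>R w \<in> interior K \<longleftrightarrow> k < l" for k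
  proof
    show "k < l" if k: "real k *\<^sub>R w \<in> interior K"
    proof (rule ccontr)
      assume "\<not> k < l"
      show False
      proof (cases "k = l")
        case True then show False using l k by simp
      next
        case False
        have "(real l / real k) *\<^sub>R (real k *\<^sub>R w) \<in> interior K"
          by (rule scale_interior) (use k interior_subset False \<open>\<not> k < l\<close> in auto)
        then show False using l False \<open>\<not> k < l\<close> by simp
      qed
    qed
  qed (rule less)
  have "l \<ge> 2"
  proof (rule ccontr)
    assume "\<not> l \<ge> 2"
    then have "l = 0 \<or> l = 1" by auto
    then show False using l zero_interior wi(2) by auto
  qed
  moreover have "of_int k *\<^sub>R w \<in> interior K \<longleftrightarrow> \<bar>k\<bar> < int l" for k
  proof (cases "k \<ge> 0")
    case True
    then show ?thesis using nat[of "nat k"] by auto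
  next
    case False
    have "of_int k *\<^sub>R w \<in> interior K \<longleftrightarrow> of_int (- k) *\<^sub>R w \<in> interior K"
      using interior_minus[of "of_int k *\<^sub>R w"] interior_minus[of "of_int (- k) *\<^sub>R w"] by auto
    also have "\<dots> \<longleftrightarrow> - k < int l" using nat[of "nat (- k)"] False by auto
    finally show ?thesis using False by simp
  qed
  ultimately have "long_body K w l" using wi(1) prim by unfold_locales auto
  then show ?thesis by blast
qed

end

section \<open>Residue classes modulo 3 and \<open>w\<close>\<close>

context long_body
begin

definition pivot :: 'n where "pivot = (SOME i. \<lfloor>w $ i\<rfloor> mod 3 \<noteq> 0)"

definition wp :: int where "wp = \<lfloor>w $ pivot\<rfloor>"

text \<open>A primitive \<open>w\<close> is not divisible by 3, so the choice of
  \<open>pivot\<close> succeeds, and every unit modulo 3 is its own inverse.\<close>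

lemma wp_square: "(1 - wp * wp) mod 3 = 0"
proof -
  have "\<exists>i. \<lfloor>w $ i\<rfloor> mod 3 \<noteq> 0"
  proof (rule ccontr)
    assume "\<not> ?thesis"
    then have "res3 w = res3 0" by (simp add: res3_def)
    then have "int_point ((1/3) *\<^sub>R w)" using res3_eq_iff[OF w_int, of 0] by (simp add: cong3_def)
    then have "(1/3::real) \<in> \<int>" by (rule primitive)
    then show False by simp
  qed
  then have "wp mod 3 \<noteq> 0" unfolding pivot_def wp_def by (rule someI_ex)
  then have "wp mod 3 = 1 \<or> wp mod 3 = 2" by presburger
  then have "(wp mod 3) * (wp mod 3) mod 3 = 1" by auto
  then have "wp * wp mod 3 = 1" by (simp add: mod_mult_eq)
  then show ?thesis by presburger
qed

text \<open>Subtracting the multiple of \<open>w\<close> clears the pivot coordinate modulo 3.\<close>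

definition cls :: "real^'n \<Rightarrow> 'n \<Rightarrow> int" where
  "cls v = res3 (v - of_int (\<lfloor>v $ pivot\<rfloor> * wp) *\<^sub>R w)"

definition classes :: "('n \<Rightarrow> int) set" where
  "classes = PiE UNIV (\<lambda>i. if i = pivot then {0} else {0..<3})"

lemma floor_add_int_point:
  assumes "int_point x" "int_point y"
  shows "\<lfloor>(x + y) $ i\<rfloor> = \<lfloor>x $ i\<rfloor> + \<lfloor>y $ i\<rfloor>"
proof -
  have "of_int \<lfloor>x $ i\<rfloor> = x $ i" "of_int \<lfloor>y $ i\<rfloor> = y $ i" using assms by (simp_all add: int_point_def)
  then show ?thesis by (metis floor_of_int of_int_add vector_add_component)
qed

lemma floor_scale_int_point:
  assumes "int_point x"
  shows "\<lfloor>(of_int k *\<^sub>R x) $ i\<rfloor> = k * \<lfloor>x $ i\<rfloor>"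
proof -
  have "of_int \<lfloor>x $ i\<rfloor> = x $ i" using assms by (simp add: int_point_def)
  then show ?thesis by (metis floor_of_int of_int_mult vector_scaleR_component real_scaleR_def)
qed

lemma card_classes: "card classes = 3 ^ (CARD('n) - 1)"
proof -
  have "card classes = (\<Prod>i\<in>UNIV. if i = pivot then 1 else 3)"
    unfolding classes_def by (subst card_PiE) (auto intro!: prod.cong)
  also have "\<dots> = (\<Prod>i\<in>UNIV - {pivot}. 3)"
    by (subst prod.remove[of _ pivot]) (auto intro!: prod.cong)
  finally show ?thesis by (simp add: card_Diff_singleton)
qed

lemma finite_classes: "finite classes"
  unfolding classes_def by (rule finite_PiE) auto

lemma cls_in_classes:
  assumes v: "int_point v" shows "cls v \<in> classes"
proof -
  have "v - of_int (\<lfloor>v $ pivot\<rfloor> * wp) *\<^sub>R w = v + of_int (- (\<lfloor>v $ pivot\<rfloor> * wp)) *\<^sub>R w" by simp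
  then have "\<lfloor>(v - of_int (\<lfloor>v $ pivot\<rfloor> * wp) *\<^sub>R w) $ pivot\<rfloor> = \<lfloor>v $ pivot\<rfloor> + - (\<lfloor>v $ pivot\<rfloor> * wp) * wp"
    using floor_add_int_point[OF v int_point_scale[OF w_int]] floor_scale_int_point[OF w_int] wp_def by metis
  also have "\<dots> = \<lfloor>v $ pivot\<rfloor> * (1 - wp * wp)" by (simp add: algebra_simps)
  also have "\<dots> mod 3 = 0" using wp_square by (metis mod_mult_right_eq mult_zero_right mod_0)
  finally show ?thesis by (auto simp: cls_def classes_def res3_def)
qed

text \<open>The shift raises the pivot coordinate by \<open>k * wp\<close>, so the vector inside
  \<open>cls\<close> changes by \<open>k * (1 - wp * wp)\<close> times \<open>w\<close>, which is 0
  modulo 3.\<close>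

lemma cls_shift:
  assumes v: "int_point v" shows "cls (v + of_int k *\<^sub>R w) = cls v"
proof -
  let ?f = "\<lfloor>v $ pivot\<rfloor>"
  have fl: "\<lfloor>(v + of_int k *\<^sub>R w) $ pivot\<rfloor> = ?f + k * wp"
    using floor_add_int_point[OF v int_point_scale[OF w_int]] floor_scale_int_point[OF w_int]
    by (simp add: wp_def)
  have eq: "v + of_int k *\<^sub>R w - of_int ((?f + k * wp) * wp) *\<^sub>R w
      = v - of_int (?f * wp) *\<^sub>R w + of_int (k * (1 - wp * wp)) *\<^sub>R w"
    by (simp add: algebra_simps)
  have "k * (1 - wp * wp) mod 3 = 0 mod 3"
    using wp_square by (metis mod_mult_right_eq mult_zero_right)
  then have "cong3 (of_int (k * (1 - wp * wp)) *\<^sub>R w) (of_int 0 *\<^sub>R w)"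
    by (rule cong3_int_mod[OF w_int])
  then have "cong3 (v - of_int (?f * wp) *\<^sub>R w + of_int (k * (1 - wp * wp)) *\<^sub>R w)
      (v - of_int (?f * wp) *\<^sub>R w + of_int 0 *\<^sub>R w)"
    by (rule cong3_add[OF cong3_refl])
  then show ?thesis
    unfolding cls_def fl eq
    by (subst res3_eq_iff) (use v w_int in \<open>auto intro!: int_point_add int_point_diff int_point_scale simp del: of_int_mult of_int_diff\<close>)
qed

lemma cls_eq_cong:
  assumes u: "int_point u" and v: "int_point v" and eq: "cls u = cls v"
  shows "\<exists>k. cong3 u (v + of_int k *\<^sub>R w)"
proof -
  let ?a = "\<lfloor>u $ pivot\<rfloor> * wp" and ?b = "\<lfloor>v $ pivot\<rfloor> * wp"
  have "cong3 (u - of_int ?a *\<^sub>R w) (v - of_int ?b *\<^sub>R w)"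
    using eq unfolding cls_def
    by (subst (asm) res3_eq_iff) (use u v w_int in \<open>auto intro!: int_point_diff int_point_scale simp del: of_int_mult\<close>)
  then have "cong3 (u - of_int ?a *\<^sub>R w + of_int ?a *\<^sub>R w) (v - of_int ?b *\<^sub>R w + of_int ?a *\<^sub>R w)"
    by (rule cong3_add) simp
  moreover have "v - of_int ?b *\<^sub>R w + of_int ?a *\<^sub>R w = v + of_int (?a - ?b) *\<^sub>R w"
    by (simp add: algebra_simps)
  ultimately have "cong3 u (v + of_int (?a - ?b) *\<^sub>R w)" by (simp only: diff_add_cancel)
  then show ?thesis by blast
qed

definition fibre :: "('n \<Rightarrow> int) \<Rightarrow> (real^'n) set" where
  "fibre c = {x \<in> pts. cls x = c}"

lemma fibre_bound:
  shows "card (fibre c) \<le> card ipts + 2"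
    and "card (fibre c) = card ipts + 2 \<Longrightarrow>
      card ipts = 2 * l - 1 \<and> (\<exists>m. (\<lambda>k. m + of_int k *\<^sub>R w) ` {- int l..int l} = fibre c)"
proof -
  have 1: "fibre c \<subseteq> pts" by (auto simp: fibre_def)
  have 2: "x + of_int k *\<^sub>R w \<in> fibre c" if "x \<in> fibre c" "x + of_int k *\<^sub>R w \<in> pts" for x k
    using that cls_shift[of x k] by (auto simp: fibre_def pts_def)
  have 3: "\<exists>k. cong3 x (y + of_int k *\<^sub>R w)" if "x \<in> fibre c" "y \<in> fibre c" for x y
    using that cls_eq_cong[of x y] by (auto simp: fibre_def pts_def)
  show "card (fibre c) \<le> card ipts + 2" by (rule residue_class_bound(1)[OF 1 2 3])
  show "card ipts = 2 * l - 1 \<and> (\<exists>m. (\<lambda>k. m + of_int k *\<^sub>R w) ` {- int l..int l} = fibre c)"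
    if "card (fibre c) = card ipts + 2" by (rule residue_class_bound(2)[OF 1 2 3 that])
qed

lemma card_pts_fibres: "card pts = (\<Sum>c\<in>classes. card (fibre c))"
proof -
  have "pts = (\<Union>c\<in>classes. fibre c)"
    using cls_in_classes by (auto simp: fibre_def pts_def)
  moreover have "card (\<Union>c\<in>classes. fibre c) = (\<Sum>c\<in>classes. card (fibre c))"
    by (rule card_UN_disjoint) (use finite_classes finite_pts in \<open>auto simp: fibre_def\<close>)
  ultimately show ?thesis by simp
qed

theorem card_pts_le: "card pts \<le> 3 ^ (CARD('n) - 1) * (card ipts + 2)"
  unfolding card_pts_fibres using sum_bounded_above[of classes "\<lambda>c. card (fibre c)" "card ipts + 2"]
    fibre_bound(1) card_classes by simp

lemma fibre_full:
  assumes eq: "card pts = 3 ^ (CARD('n) - 1) * (card ipts + 2)" and c: "c \<in> classes"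
  shows "card (fibre c) = card ipts + 2"
proof (rule ccontr)
  assume "card (fibre c) \<noteq> card ipts + 2"
  then have "card (fibre c) < card ipts + 2" using fibre_bound(1)[of c] by simp
  then have "(\<Sum>c\<in>classes. card (fibre c)) < (\<Sum>c\<in>classes. card ipts + 2)"
    using finite_classes fibre_bound(1) c by (intro sum_strict_mono_ex1) auto
  then show False using eq card_pts_fibres card_classes by simp
qed

end

section \<open>The equality case reduced to the cube\<close>

locale saturated_body = long_body K w l for K :: "(real^'n) set" and w l +
  assumes full_segment: "int_point v \<Longrightarrow> \<exists>m k. int_point m \<and> \<bar>k\<bar> \<le> (1::int) \<and> cong3 v (m + of_int k *\<^sub>R w)
      \<and> m + real l *\<^sub>R w \<in> K \<and> m - real l *\<^sub>R w \<in> K"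
    and ipts_eq: "ipts = (\<lambda>k::int. of_int k *\<^sub>R w) ` {- (int l - 1)..int l - 1}"

text \<open>Every class attains its bound, so it is one segment of \<open>2 * l + 1\<close> points
  centred at some \<open>m\<close>; the count of interior points leaves only the multiples of
  \<open>w\<close>.\<close>

lemma (in long_body) equality_saturated:
  assumes eq: "card pts = 3 ^ (CARD('n) - 1) * (card ipts + 2)"
  shows "saturated_body K w l"
proof
  have "card ipts = 2 * l - 1"
    using fibre_bound(2)[OF fibre_full[OF eq cls_in_classes[OF int_point_0]]] by blast
  then show "ipts = (\<lambda>k::int. of_int k *\<^sub>R w) ` {- (int l - 1)..int l - 1}"
    using card_subset_eq[OF finite_ipts central_ipts] card_central by simp
  fix v :: "real^'n" assume v: "int_point v"
  obtain m where m: "(\<lambda>k. m + of_int k *\<^sub>R w) ` {- int l..int l} = fibre (cls v)"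
    using fibre_bound(2)[OF fibre_full[OF eq cls_in_classes[OF v]]] by blast
  have mk: "m + of_int k *\<^sub>R w \<in> fibre (cls v)" if "\<bar>k\<bar> \<le> int l" for k
    using that by (auto simp: m[symmetric] abs_le_iff intro!: imageI)
  have m0: "m \<in> fibre (cls v)" using mk[of 0] by simp
  then have mi: "int_point m" "cls m = cls v" by (auto simp: fibre_def pts_def)
  obtain k where k: "cong3 v (m + of_int k *\<^sub>R w)" using cls_eq_cong[OF v mi(1)] mi(2) by auto
  \<comment> \<open>The representative of \<open>k\<close> modulo 3 among -1, 0 and 1.\<close>
  define k' where "k' = (k + 1) mod 3 - 1"
  have k': "\<bar>k'\<bar> \<le> 1" "k mod 3 = k' mod 3" unfolding k'_def by presburger+
  have "cong3 (m + of_int k *\<^sub>R w) (m + of_int k' *\<^sub>R w)"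
    by (rule cong3_add[OF cong3_refl cong3_int_mod[OF w_int k'(2)]])
  then have "cong3 v (m + of_int k' *\<^sub>R w)" using k cong3_trans by blast
  moreover have "m + real l *\<^sub>R w \<in> K" "m - real l *\<^sub>R w \<in> K"
    using mk[of "int l"] mk[of "- int l"] by (auto simp: fibre_def pts_def)
  ultimately show "\<exists>m k. int_point m \<and> \<bar>k\<bar> \<le> (1::int) \<and> cong3 v (m + of_int k *\<^sub>R w)
      \<and> m + real l *\<^sub>R w \<in> K \<and> m - real l *\<^sub>R w \<in> K"
    using mi(1) k'(1) by blast
qed

context saturated_body
begin

text \<open>The midpoints of segments of half-length \<open>l - 1\<close> along \<open>w\<close>
  with ends in \<open>K\<close>. If \<open>K\<close> is a box of half-length \<open>l\<close> in
  direction \<open>w\<close> and 1 otherwise, this is the cube of half-length 1.\<close>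

definition core :: "(real^'n) set" where
  "core = {x. x + (real l - 1) *\<^sub>R w \<in> K \<and> x - (real l - 1) *\<^sub>R w \<in> K}"

lemma core_alt:
  "core = (+) (- ((real l - 1) *\<^sub>R w)) ` K \<inter> (+) ((real l - 1) *\<^sub>R w) ` K"
proof -
  have "x \<in> (+) a ` K \<longleftrightarrow> x - a \<in> K" for x a
    by (auto intro!: image_eqI[of _ _ "x - a"])
  note * = this
  show ?thesis by (simp only: set_eq_iff Int_iff * core_def mem_Collect_eq diff_minus_eq_add) simp
qed

lemma interior_core: "x \<in> interior core \<longleftrightarrow>
    x + (real l - 1) *\<^sub>R w \<in> interior K \<and> x - (real l - 1) *\<^sub>R w \<in> interior K"
proof -
  have "x \<in> (+) a ` interior K \<longleftrightarrow> x - a \<in> interior K" for x a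
    by (auto intro!: image_eqI[of _ _ "x - a"])
  note * = this
  show ?thesis
    by (simp only: core_alt interior_Int interior_translation Int_iff * diff_minus_eq_add)
qed

lemma segment_in:
  assumes "y + u \<in> K" "y - u \<in> K" "\<bar>t\<bar> \<le> 1"
  shows "y + t *\<^sub>R u \<in> K"
proof -
  have "((1 + t) / 2) *\<^sub>R (y + u) + ((1 - t) / 2) *\<^sub>R (y - u) \<in> K"
    by (rule convexD[OF convex assms(1,2)]) (use assms(3) in \<open>auto simp: field_simps\<close>)
  moreover have "((1 + t) / 2) *\<^sub>R (y + u) + ((1 - t) / 2) *\<^sub>R (y - u) = y + t *\<^sub>R u"
    by (simp add: vec_eq_iff field_simps)
  ultimately show ?thesis by simp
qed

lemma core_segment:
  assumes "m + real l *\<^sub>R w \<in> K" "m - real l *\<^sub>R w \<in> K" "\<bar>k\<bar> \<le> (1::int)"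
  shows "m + of_int k *\<^sub>R w \<in> core"
proof -
  have "m + s *\<^sub>R w \<in> K" if "\<bar>s\<bar> \<le> real l" for s
    using segment_in[OF assms(1,2), of "s / real l"] that l_ge by (simp add: field_simps)
  moreover have "\<bar>of_int k + (real l - 1)\<bar> \<le> real l" "\<bar>of_int k - (real l - 1)\<bar> \<le> real l"
    using assms(3) l_ge by linarith+
  ultimately have "m + (of_int k + (real l - 1)) *\<^sub>R w \<in> K" "m + (of_int k - (real l - 1)) *\<^sub>R w \<in> K"
    by blast+
  then show ?thesis by (simp add: core_def algebra_simps)
qed

lemma ipts_multiple: "x \<in> interior K \<Longrightarrow> int_point x \<Longrightarrow> \<exists>k. x = of_int k *\<^sub>R w \<and> \<bar>k\<bar> < int l"
proof -
  assume "x \<in> interior K" "int_point x"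
  then have "x \<in> ipts" by (simp add: ipts_def)
  then obtain k where "x = of_int k *\<^sub>R w" "k \<in> {- (int l - 1)..int l - 1}"
    unfolding ipts_eq by blast
  then show ?thesis by auto
qed

lemma symmetric_core: "symmetric_body core"
proof
  show "compact core"
    unfolding core_alt by (intro compact_Int compact_translation compact)
  show "convex core"
    unfolding core_alt by (intro convex_Int convex_translation convex)
  show "- x \<in> core" if "x \<in> core" for x
    using that symmetric[of "x + (real l - 1) *\<^sub>R w"] symmetric[of "x - (real l - 1) *\<^sub>R w"]
    by (simp add: core_def)
  show "0 \<in> interior core"
    using multiples_interior[of "int l - 1"] interior_minus l_ge by (simp add: interior_core)
qed

text \<open>Moving \<open>x\<close> by \<open>l - 1\<close> steps of \<open>w\<close> either way
  gives interior lattice points, hence multiples of \<open>w\<close> with coefficients below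
  \<open>l\<close> in absolute value. Coefficients differing by \<open>2 * (l - 1)\<close> must be
  the two extreme ones.\<close>

lemma core_interior_trivial:
  assumes x: "x \<in> interior core" "int_point x"
  shows "x = 0"
proof -
  have c: "int_point ((real l - 1) *\<^sub>R w)" using int_point_scale[OF w_int, of "int l - 1"] by simp
  obtain k where k: "x + (real l - 1) *\<^sub>R w = of_int k *\<^sub>R w" "\<bar>k\<bar> < int l"
    using ipts_multiple x c interior_core int_point_add by blast
  obtain k' where k': "x - (real l - 1) *\<^sub>R w = of_int k' *\<^sub>R w" "\<bar>k'\<bar> < int l"
    using ipts_multiple x c interior_core int_point_diff by blast
  have "2 *\<^sub>R ((real l - 1) *\<^sub>R w) = of_int k *\<^sub>R w - of_int k' *\<^sub>R w"
    unfolding k(1)[symmetric] k'(1)[symmetric] scaleR_2 by simp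
  then have "(of_int k - of_int k' - 2 * (real l - 1)) *\<^sub>R w = 0"
    by (simp add: algebra_simps)
  then have "real_of_int k - of_int k' = 2 * (real l - 1)" using w_nonzero by simp
  then have "real_of_int (k - k') = real_of_int (2 * (int l - 1))" by simp
  then have "k - k' = 2 * (int l - 1)" by (simp only: of_int_eq_iff)
  then have "k = int l - 1" using k(2) k'(2) by presburger
  then show "x = 0" using k(1) by simp
qed

lemma full_core: "full_body core"
proof -
  interpret core: symmetric_body core by (rule symmetric_core)
  show ?thesis
  proof
    show "x = 0" if "x \<in> interior core" "int_point x" for x
      using core_interior_trivial that .
    show "\<exists>p\<in>core.pts. cong3 p v" if v: "int_point v" for v
    proof -
      obtain m k where mk: "int_point m" "\<bar>k\<bar> \<le> (1::int)" "cong3 v (m + of_int k *\<^sub>R w)"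
          "m + real l *\<^sub>R w \<in> K" "m - real l *\<^sub>R w \<in> K"
        using full_segment[OF v] by blast
      have "m + of_int k *\<^sub>R w \<in> core.pts"
        using core_segment[OF mk(4,5,2)] mk(1) w_int
        by (auto simp: core.pts_def intro: int_point_add int_point_scale)
      then show ?thesis using cong3_sym[OF mk(3)] by blast
    qed
  qed
qed

text \<open>The segment point congruent to \<open>p\<close> also lies in \<open>core\<close>; a
  third of the difference is an interior lattice point of \<open>core\<close>, so the two points
  coincide.\<close>

lemma core_pts_segment:
  assumes "p \<in> core" "int_point p"
  obtains m k where "\<bar>k\<bar> \<le> (1::int)" "p = m + of_int k *\<^sub>R w" "m + w \<in> core" "m - w \<in> core"
proof -
  interpret core: symmetric_body core by (rule symmetric_core)
  obtain m k where mk: "int_point m" "\<bar>k\<bar> \<le> (1::int)" "cong3 p (m + of_int k *\<^sub>R w)"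
      "m + real l *\<^sub>R w \<in> K" "m - real l *\<^sub>R w \<in> K"
    using full_segment[OF assms(2)] by blast
  have "(1/3) *\<^sub>R (p - (m + of_int k *\<^sub>R w)) \<in> interior core"
    by (rule core.third_diff_interior[OF assms(1) core_segment[OF mk(4,5,2)]])
  then have "(1/3) *\<^sub>R (p - (m + of_int k *\<^sub>R w)) = 0"
    using mk(3) by (intro core_interior_trivial) (auto simp: cong3_def)
  then have "p = m + of_int k *\<^sub>R w" by simp
  then show ?thesis
    using that[OF mk(2)] core_segment[OF mk(4,5), of 1] core_segment[OF mk(4,5), of "-1"] by simp
qed

lemma end_in: "real l *\<^sub>R w \<in> K"
proof -
  obtain m where m: "m + real l *\<^sub>R w \<in> K" "m - real l *\<^sub>R w \<in> K"
    using full_segment[OF int_point_0] by blast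
  have "(1/2) *\<^sub>R (m + real l *\<^sub>R w) + (1/2) *\<^sub>R (- (m - real l *\<^sub>R w)) \<in> K"
    using convexD[OF convex m(1) symmetric[OF m(2)]] by simp
  then show ?thesis by (simp add: algebra_simps flip: scaleR_add_left)
qed

theorem is_stretched_cube:
  obtains f a j where "dual_lattice_bases f a"
    "K = {x. \<forall>i. \<bar>a i \<bullet> x\<bar> \<le> (if i = j then real l else 1)}"
proof -
  interpret core: full_body core by (rule full_core)
  obtain f a where fa: "dual_lattice_bases f a" and coreq: "core = {x. \<forall>i. \<bar>a i \<bullet> x\<bar> \<le> 1}"
    using core.is_cube by blast
  have f_int: "int_point (f i)" and a_int: "int_point v \<Longrightarrow> a i \<bullet> v \<in> \<int>"
    and af: "a i \<bullet> f k = (if i = k then 1 else 0)" and expand: "(\<Sum>i\<in>UNIV. (a i \<bullet> x) *\<^sub>R f i) = x"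
    for i k v x using fa by (auto simp: dual_lattice_bases_def)
  have "real l *\<^sub>R w - (real l - 1) *\<^sub>R w = w" by (simp add: algebra_simps)
  moreover have "w + (real l - 1) *\<^sub>R w = real l *\<^sub>R w" by (simp add: algebra_simps)
  moreover have "w - (real l - 1) *\<^sub>R w = - ((real l - 2) *\<^sub>R w)"
    by (simp add: algebra_simps flip: scaleR_2)
  moreover have "(real l - 2) *\<^sub>R w \<in> K"
    using multiples_interior[of "int l - 2"] l_ge interior_subset by auto
  ultimately have w_core: "w \<in> core"
    using end_in symmetric by (simp add: core_def)
  have aw: "a i \<bullet> w \<in> {-1, 0, 1}" for i
  proof -
    obtain z :: int where z: "a i \<bullet> w = of_int z" using a_int[OF w_int, of i] by (auto elim: Ints_cases)
    have "\<bar>a i \<bullet> w\<bar> \<le> 1" using w_core coreq by blast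
    then have "\<bar>z\<bar> \<le> 1" unfolding z by linarith
    then have "z = -1 \<or> z = 0 \<or> z = 1" by linarith
    then show ?thesis using z by auto
  qed
  have "\<exists>j. a j \<bullet> w \<noteq> 0"
  proof (rule ccontr)
    assume "\<not> ?thesis"
    then have "w = 0" using expand[of w] by simp
    then show False using w_nonzero by simp
  qed
  then obtain j where j: "a j \<bullet> w \<noteq> 0" by blast
  \<comment> \<open>Given two nonzero coordinates of \<open>w\<close>, flip the sign of one and drop
    the rest to get \<open>p\<close>. In \<open>p = m + of_int k *\<^sub>R w\<close> the point
    \<open>m\<close> vanishes at both coordinates, as \<open>m + w\<close> and \<open>m - w\<close>
    are in the cube, so \<open>k\<close> would be 1 and -1.\<close>
  have others: "a i \<bullet> w = 0" if "i \<noteq> j" for i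
  proof (rule ccontr)
    assume i: "a i \<bullet> w \<noteq> 0"
    define p where "p = (a j \<bullet> w) *\<^sub>R f j - (a i \<bullet> w) *\<^sub>R f i"
    have ap: "a k \<bullet> p = (if k = j then a j \<bullet> w else if k = i then - (a i \<bullet> w) else 0)" for k
      using that by (simp add: p_def inner_diff_right af)
    have "p \<in> core" using aw[of i] aw[of j] by (auto simp: coreq ap)
    moreover have "int_point p"
    proof -
      obtain y z :: int where "a j \<bullet> w = of_int y" "a i \<bullet> w = of_int z"
        using a_int[OF w_int] by (metis Ints_cases)
      then show ?thesis unfolding p_def by (simp add: int_point_diff int_point_scale f_int)
    qed
    ultimately obtain m k where mk: "\<bar>k\<bar> \<le> (1::int)" "p = m + of_int k *\<^sub>R w" "m + w \<in> core" "m - w \<in> core"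
      by (rule core_pts_segment)
    have am: "a h \<bullet> m = 0" if "a h \<bullet> w \<noteq> 0" for h
    proof -
      have "\<bar>a h \<bullet> (m + w)\<bar> \<le> 1" "\<bar>a h \<bullet> (m - w)\<bar> \<le> 1" using mk(3,4) coreq by blast+
      then show ?thesis using aw[of h] that by (auto simp: inner_add_right inner_diff_right)
    qed
    have "a j \<bullet> w = of_int k * (a j \<bullet> w)" "- (a i \<bullet> w) = of_int k * (a i \<bullet> w)"
      using ap[of j] ap[of i] am[OF j] am[OF i] \<open>i \<noteq> j\<close> mk(2) by (auto simp: inner_add_right)
    then show False using i j by (auto simp: field_simps)
  qed
  define \<sigma> where "\<sigma> = a j \<bullet> w"
  have \<sigma>: "\<sigma> = 1 \<or> \<sigma> = -1" using aw[of j] j by (auto simp: \<sigma>_def)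
  have wf: "w = \<sigma> *\<^sub>R f j"
  proof -
    have "(\<Sum>i\<in>UNIV. (a i \<bullet> w) *\<^sub>R f i) = (\<Sum>i\<in>UNIV. if i = j then (a j \<bullet> w) *\<^sub>R f j else 0)"
      by (rule sum.cong) (auto simp: others)
    then show ?thesis using expand[of w] by (simp add: \<sigma>_def)
  qed
  have fw: "f j = \<sigma> *\<^sub>R w" using wf \<sigma> by auto
  define b where "b i = (if i = j then real l else 1)" for i
  have b1: "b i \<ge> 1" for i using l_ge by (simp add: b_def)
  have box_in: "x \<in> K" if x: "\<And>i. \<bar>a i \<bullet> x\<bar> \<le> b i" for x
  proof -
    define t where "t = a j \<bullet> x / real l"
    have t: "\<bar>t\<bar> \<le> 1" using x[of j] l_ge by (simp add: t_def b_def field_simps)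
    \<comment> \<open>Pull \<open>x\<close> back along \<open>f j\<close> into \<open>core\<close>;
      it lies on the segment of half-length \<open>l - 1\<close> around \<open>y\<close>.\<close>
    define y where "y = x - (t * (real l - 1)) *\<^sub>R f j"
    have ajx: "a j \<bullet> x = t * real l" using l_ge by (simp add: t_def)
    have "a i \<bullet> y = (if i = j then t else a i \<bullet> x)" for i
      using ajx by (auto simp: y_def inner_diff_right af algebra_simps)
    moreover have "\<bar>a i \<bullet> x\<bar> \<le> 1" if "i \<noteq> j" for i using x[of i] that by (simp add: b_def)
    ultimately have y: "y \<in> core" using t by (simp add: coreq)
    have "y + (t * \<sigma>) *\<^sub>R ((real l - 1) *\<^sub>R w) \<in> K"
      by (rule segment_in) (use y t \<sigma> in \<open>auto simp: core_def\<close>)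
    moreover have "y + (t * \<sigma>) *\<^sub>R ((real l - 1) *\<^sub>R w) = x"
      using \<sigma> by (auto simp: y_def fw)
    ultimately show ?thesis by simp
  qed
  have box_interior: "x \<in> interior K" if x: "\<And>i. \<bar>a i \<bullet> x\<bar> < b i" for x
  proof (rule interiorI)
    have "{x. \<forall>i. \<bar>a i \<bullet> x\<bar> < b i} = (\<Inter>i. {x. \<bar>a i \<bullet> x\<bar> < b i})" by blast
    then show "open {x. \<forall>i. \<bar>a i \<bullet> x\<bar> < b i}"
      by (auto intro!: open_INT open_Collect_less continuous_intros)
    show "x \<in> {x. \<forall>i. \<bar>a i \<bullet> x\<bar> < b i}" using x by blast
    show "{x. \<forall>i. \<bar>a i \<bullet> x\<bar> < b i} \<subseteq> K" using box_in less_imp_le by blast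
  qed
  \<comment> \<open>For \<open>j\<close> the facet centre is \<open>l\<close> times \<open>w\<close>
    up to sign; the other centres are lattice points but not multiples of \<open>w\<close>.\<close>
  have centre_not_interior: "b i *\<^sub>R f i \<notin> interior K" for i
  proof
    assume int: "b i *\<^sub>R f i \<in> interior K"
    show False
    proof (cases "i = j")
      case True
      then have "(real l * \<sigma>) *\<^sub>R w \<in> interior K" using int by (simp add: b_def fw)
      then show False
        using \<sigma> multiples_interior[of "int l"] multiples_interior[of "- int l"] by auto
    next
      case False
      then obtain k where "f i = of_int k *\<^sub>R w"
        using int ipts_multiple[of "f i"] f_int by (auto simp: b_def)
      then have "a i \<bullet> f i = of_int k * (a i \<bullet> w)" by simp
      then show False using af[of i i] others[OF False] by simp
    qed
  qed
  \<comment> \<open>A point of \<open>K\<close> beyond a facet would make the facet centre interior,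
    being a convex combination of that point and a point \<open>z\<close> inside the open
    box.\<close>
  have le: "a i \<bullet> x \<le> b i" if x: "x \<in> K" for i x
  proof (rule ccontr)
    assume gt: "\<not> ?thesis"
    define M where "M = (\<Sum>k\<in>UNIV. \<bar>a k \<bullet> x\<bar>)"
    have M: "\<bar>a k \<bullet> x\<bar> \<le> M" for k
      unfolding M_def by (rule member_le_sum) auto
    have M0: "M \<ge> 0" using M[of i] by linarith
    \<comment> \<open>Close enough to 1 that
      \<open>(1 - t) * \<bar>a k \<bullet> x\<bar> < t\<close> for all \<open>k\<close>, which keeps
      \<open>z\<close> inside the box.\<close>
    define t where "t = (M + 1) / (M + 2)"
    have t: "0 < t" "t \<le> 1" "1 - t = 1 / (M + 2)" using M0 by (auto simp: t_def field_simps)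
    define z where "z = (1 / t) *\<^sub>R (b i *\<^sub>R f i - (1 - t) *\<^sub>R x)"
    have small: "(1 - t) * \<bar>a k \<bullet> x\<bar> < t" for k
    proof -
      have "\<bar>a k \<bullet> x\<bar> / (M + 2) < (M + 1) / (M + 2)"
        using M[of k] M0 by (intro divide_strict_right_mono) auto
      then show ?thesis by (simp add: t(3)) (simp add: t_def)
    qed
    have az: "a k \<bullet> z = ((if k = i then b i else 0) - (1 - t) * (a k \<bullet> x)) / t" for k
      by (simp add: z_def inner_diff_right af)
    have "\<bar>a k \<bullet> z\<bar> < b k" for k
    proof (cases "k = i")
      case True
      have "(1 - t) * b i < (1 - t) * (a i \<bullet> x)" using gt t M0 by (intro mult_strict_left_mono) auto
      then have 1: "b i - (1 - t) * (a i \<bullet> x) < t * b i" by (simp add: algebra_simps)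
      have "(1 - t) * (a i \<bullet> x) \<le> (1 - t) * \<bar>a i \<bullet> x\<bar>" using M0 by (intro mult_left_mono) (auto simp: t(3))
      then have "(1 - t) * (a i \<bullet> x) < 1" using small[of i] t by linarith
      then have 2: "0 < b i - (1 - t) * (a i \<bullet> x)" using b1[of i] by linarith
      have "\<bar>a i \<bullet> z\<bar> = (b i - (1 - t) * (a i \<bullet> x)) / t" using 2 t(1) by (simp add: az)
      also have "\<dots> < b i" using 1 t(1) by (simp add: pos_divide_less_eq mult.commute)
      finally show ?thesis using True by simp
    next
      case False
      have "\<bar>a k \<bullet> z\<bar> = (1 - t) * \<bar>a k \<bullet> x\<bar> / t"
        using t(1,2) False by (simp add: az abs_mult abs_divide)
      also have "\<dots> < 1" using small[of k] t(1) by simp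
      finally show ?thesis using b1[of k] by linarith
    qed
    then have "z \<in> interior K" by (rule box_interior)
    from interior_comb[OF x this t(1,2)] have "b i *\<^sub>R f i \<in> interior K"
      using t by (simp add: z_def)
    then show False using centre_not_interior by blast
  qed
  have "K = {x. \<forall>i. \<bar>a i \<bullet> x\<bar> \<le> b i}"
  proof (intro equalityI subsetI)
    fix x assume x: "x \<in> K"
    have "\<bar>a i \<bullet> x\<bar> \<le> b i" for i
      using le[OF x, of i] le[OF symmetric[OF x], of i] by auto
    then show "x \<in> {x. \<forall>i. \<bar>a i \<bullet> x\<bar> \<le> b i}" by blast
  qed (use box_in in blast)
  then show ?thesis using that[OF fa] by (simp add: b_def)
qed

end

subsection \<open>Unimodular equivalence and counting in parallelepipeds\<close>

lemma invertible_matrix_inv: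
  assumes "invertible A"
  shows "A ** matrix_inv A = mat 1" "matrix_inv A ** A = mat 1"
  using someI_ex[OF assms[unfolded invertible_def]] by (simp_all add: matrix_inv_def)

text \<open>The matrix with columns \<open>f k\<close> has the inverse with rows \<open>a i\<close>;
  the latter is integral because its entries are values of \<open>a i\<close> at unit
  vectors.\<close>

lemma dual_lattice_bases_unimod_equiv:
  fixes f a :: "'n \<Rightarrow> real^'n"
  assumes fa: "dual_lattice_bases f a"
    and K: "K = {x. \<forall>i. \<bar>a i \<bullet> x\<bar> \<le> (if i = j then real l else 1)}"
  shows "unimod_equiv K (para j l)"
proof -
  have f_int: "int_point (f i)" and a_int: "int_point v \<Longrightarrow> a i \<bullet> v \<in> \<int>"
    and af: "a i \<bullet> f k = (if i = k then 1 else 0)" and expand: "(\<Sum>i\<in>UNIV. (a i \<bullet> x) *\<^sub>R f i) = x"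
    for i k v x using fa by (auto simp: dual_lattice_bases_def)
  define A :: "real^'n^'n" where "A = (\<chi> i k. f k $ i)"
  define B :: "real^'n^'n" where "B = (\<chi> i. a i)"
  have Av: "A *v y = (\<Sum>i\<in>UNIV. (y $ i) *\<^sub>R f i)" for y
    by (simp add: A_def matrix_vector_mult_def vec_eq_iff mult.commute)
  have Bv: "(B *v y) $ i = a i \<bullet> y" for y i
    by (simp add: B_def matrix_vector_mult_def inner_vec_def)
  have ABv: "A *v (B *v y) = y" for y using expand by (simp add: Av Bv)
  have AB: "A ** B = mat 1"
    by (simp add: matrix_eq ABv flip: matrix_vector_mul_assoc)
  then have BA: "B ** A = mat 1" by (simp add: matrix_left_right_inverse)
  have inv: "invertible A" unfolding invertible_def using AB BA by blast
  then have "matrix_inv A = B"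
    by (metis BA invertible_matrix_inv(1) matrix_mul_assoc matrix_mul_lid matrix_mul_rid)
  moreover have "int_matrix A" using f_int by (simp add: int_matrix_def A_def int_point_def)
  moreover have "int_matrix B"
  proof -
    have "a i $ k \<in> \<int>" for i k
    proof -
      have "int_point (axis k 1 :: real^'n)" by (simp add: int_point_def axis_def)
      from a_int[OF this, of i] show ?thesis by (simp add: inner_axis)
    qed
    then show ?thesis by (simp add: int_matrix_def B_def)
  qed
  ultimately have "unimodular A" using inv by (simp add: unimodular_def)
  moreover have "K = (*v) A ` para j l"
  proof (intro equalityI subsetI)
    fix x assume "x \<in> K"
    then have "B *v x \<in> para j l" by (simp add: K para_def Bv)
    then show "x \<in> (*v) A ` para j l" using ABv[of x] by (metis imageI)
  next
    fix x assume "x \<in> (*v) A ` para j l"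
    then obtain y where y: "y \<in> para j l" "x = A *v y" by blast
    have "B *v x = y" using y(2) BA by (simp add: matrix_vector_mul_assoc)
    then show "x \<in> K" using y(1) Bv[of x] by (auto simp: K para_def)
  qed
  ultimately show ?thesis unfolding unimod_equiv_def by blast
qed

section \<open>Counting lattice points in unimodular images and boxes\<close>

lemma int_matrix_int_point: "int_matrix A \<Longrightarrow> int_point x \<Longrightarrow> int_point (A *v x)"
  by (auto simp: int_matrix_def int_point_def matrix_vector_mult_def intro!: Ints_sum Ints_mult)

lemma G_unimodular_image:
  assumes "unimodular A"
  shows "G ((*v) A ` S) = G S"
proof -
  have A: "int_matrix A" "int_matrix (matrix_inv A)" "invertible A"
    using assms by (auto simp: unimodular_def)
  have inv: "matrix_inv A *v (A *v x) = x" for x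
    using A(3) by (simp add: matrix_vector_mul_assoc invertible_matrix_inv)
  have "(*v) A ` S \<inter> {x. int_point x} = (*v) A ` (S \<inter> {x. int_point x})"
    using int_matrix_int_point[OF A(1)] int_matrix_int_point[OF A(2)] inv by force
  moreover have "inj_on ((*v) A) (S \<inter> {x. int_point x})"
    by (rule inj_on_inverseI[of _ "(*v) (matrix_inv A)"]) (rule inv)
  ultimately show ?thesis by (simp add: G_def card_image)
qed

lemma interior_unimodular_image:
  assumes "unimodular A"
  shows "interior ((*v) A ` S) = (*v) A ` interior S"
  using assms by (intro interior_bijective_linear_image)
    (auto simp: unimodular_def invertible_eq_bij matrix_vector_mul_linear)

text \<open>Allowing a finite set of integers in each coordinate treats the closed box and its
  interior alike.\<close>

lemma G_product_set:
  fixes I :: "'n::finite \<Rightarrow> int set"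
  shows "G {x::real^'n. \<forall>i. \<exists>k\<in>I i. x $ i = of_int k} = (\<Prod>i\<in>UNIV. card (I i))"
proof -
  have "{x::real^'n. \<forall>i. \<exists>k\<in>I i. x $ i = of_int k} \<inter> {x. int_point x} = (\<lambda>h. \<chi> i. of_int (h i)) ` PiE UNIV I"
  proof (intro equalityI subsetI)
    fix x :: "real^'n" assume "x \<in> {x. \<forall>i. \<exists>k\<in>I i. x $ i = of_int k} \<inter> {x. int_point x}"
    then obtain h where h: "\<And>i. h i \<in> I i" "\<And>i. x $ i = of_int (h i)"
      by (simp add: Bex_def) metis
    show "x \<in> (\<lambda>h. \<chi> i. of_int (h i)) ` PiE UNIV I"
      by (rule image_eqI[of _ _ h]) (auto simp: vec_eq_iff h)
  qed (auto simp: int_point_def)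
  moreover have "inj_on (\<lambda>h. (\<chi> i. of_int (h i)) :: real^'n) (PiE UNIV I)"
    by (rule inj_onI) (simp add: vec_eq_iff fun_eq_iff)
  ultimately show ?thesis by (simp add: G_def card_image card_PiE)
qed

lemma G_int_cong: "(\<And>x. int_point x \<Longrightarrow> x \<in> S \<longleftrightarrow> x \<in> T) \<Longrightarrow> G S = G T"
  unfolding G_def by (rule arg_cong[of _ _ card]) auto

lemma interior_para: "interior (para j l) = {x. \<forall>i. \<bar>x $ i\<bar> < (if i = j then real l else 1)}"
proof -
  let ?b = "(\<chi> i. if i = j then real l else 1) :: real^'a"
  have "para j l = cbox (- ?b) ?b"
    by (rule set_eqI) (simp only: para_def mem_box_cart mem_Collect_eq abs_le_iff vector_uminus_component
      vec_lambda_beta, metis minus_le_iff)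
  then have "interior (para j l) = box (- ?b) ?b" by (simp add: interior_cbox)
  then show ?thesis
    by (intro set_eqI) (simp only: mem_box_cart mem_Collect_eq abs_less_iff vector_uminus_component
      vec_lambda_beta, metis minus_less_iff)
qed

lemma prod_single_out: "(\<Prod>i\<in>(UNIV::'n::finite set). if i = j then p else q) = p * q ^ (CARD('n) - 1)"
  for p q :: nat
proof -
  have "(\<Prod>i\<in>(UNIV::'n set) - {j}. if i = j then p else q) = (\<Prod>i\<in>UNIV - {j}. q)"
    by (rule prod.cong) auto
  then show ?thesis by (subst prod.remove[of _ j]) (auto simp: card_Diff_singleton)
qed

lemma int_point_of_int:
  assumes "int_point x" obtains k where "x $ i = of_int k"
  using assms that unfolding int_point_def by (meson Ints_cases)

lemma G_para: "G (para (j::'n::finite) l) = (2 * l + 1) * 3 ^ (CARD('n) - 1)"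
proof -
  define I where "I i = (if i = j then {- int l..int l} else {-1..1})" for i
  have "G (para j l) = G {x::real^'n. \<forall>i. \<exists>k\<in>I i. x $ i = of_int k}"
  proof (rule G_int_cong)
    fix x :: "real^'n" assume x: "int_point x"
    have "\<bar>x $ i\<bar> \<le> (if i = j then real l else 1) \<longleftrightarrow> (\<exists>k\<in>I i. x $ i = of_int k)" for i
    proof -
      obtain k where "x $ i = of_int k" using int_point_of_int[OF x] .
      then show ?thesis by (auto simp: I_def abs_le_iff)
    qed
    then show "x \<in> para j l \<longleftrightarrow> x \<in> {x. \<forall>i. \<exists>k\<in>I i. x $ i = of_int k}" by (simp add: para_def)
  qed
  also have "\<dots> = (\<Prod>i\<in>UNIV. card (I i))" by (rule G_product_set)
  also have "\<dots> = (\<Prod>i\<in>UNIV. if i = j then 2 * l + 1 else 3)"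
    by (rule prod.cong) (auto simp: I_def)
  finally show ?thesis by (simp only: prod_single_out)
qed

lemma G_interior_para:
  assumes "l \<ge> 1" shows "G (interior (para (j::'n::finite) l)) = 2 * l - 1"
proof -
  define I where "I i = (if i = j then {- int l + 1..int l - 1} else {0})" for i
  have "G (interior (para j l)) = G {x::real^'n. \<forall>i. \<exists>k\<in>I i. x $ i = of_int k}"
  proof (rule G_int_cong)
    fix x :: "real^'n" assume x: "int_point x"
    have "\<bar>x $ i\<bar> < (if i = j then real l else 1) \<longleftrightarrow> (\<exists>k\<in>I i. x $ i = of_int k)" for i
    proof -
      obtain k where k: "x $ i = of_int k" using int_point_of_int[OF x] .
      have "\<bar>real_of_int k\<bar> < real l \<longleftrightarrow> \<bar>k\<bar> < int l" by linarith
      moreover have "\<bar>real_of_int k\<bar> < 1 \<longleftrightarrow> k = 0" by linarith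
      ultimately show ?thesis by (auto simp: I_def k)
    qed
    then show "x \<in> interior (para j l) \<longleftrightarrow> x \<in> {x. \<forall>i. \<exists>k\<in>I i. x $ i = of_int k}"
      by (simp add: interior_para)
  qed
  also have "\<dots> = (\<Prod>i\<in>UNIV. card (I i))" by (rule G_product_set)
  also have "\<dots> = (\<Prod>i\<in>UNIV. if i = j then 2 * l - 1 else 1)"
    by (rule prod.cong) (use assms in \<open>auto simp: I_def\<close>)
  finally show ?thesis by (simp only: prod_single_out power_one mult_1_right)
qed

section \<open>The bound and the characterisation of equality\<close>

context symmetric_body
begin

lemma inj_on_res3_pts:
  assumes "ipts = {0}" shows "inj_on res3 pts"
proof (rule inj_onI)
  fix x y assume xy: "x \<in> pts" "y \<in> pts" "res3 x = res3 y"
  then have "int_point ((1/3) *\<^sub>R (x - y))"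
    using res3_eq_iff[of x y] by (simp add: pts_def cong3_def)
  moreover have "(1/3) *\<^sub>R (x - y) \<in> interior K"
    using third_diff_interior xy by (simp add: pts_def)
  ultimately have "(1/3) *\<^sub>R (x - y) \<in> ipts" by (simp add: ipts_def)
  then show "x = y" using assms by simp
qed

text \<open>Reduction modulo 3 is injective on \<open>pts\<close>, so \<open>3 ^ CARD('n)\<close>
  points meet every class.\<close>

lemma full_bodyI:
  assumes "ipts = {0}" "card pts = 3 ^ CARD('n)"
  shows "full_body K"
proof
  show "x = 0" if "x \<in> interior K" "int_point x" for x
    using that assms(1) by (auto simp: ipts_def)
  have "card (res3 ` pts) = card (PiE (UNIV::'n set) (\<lambda>_. {0..<3::int}))"
    using card_image[OF inj_on_res3_pts[OF assms(1)]] assms(2) card_residues by metis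
  moreover have "res3 ` pts \<subseteq> PiE UNIV (\<lambda>_. {0..<3})" using res3_in by blast
  ultimately have all: "res3 ` pts = PiE UNIV (\<lambda>_. {0..<3})"
    by (intro card_subset_eq finite_residues)
  show "\<exists>p\<in>pts. cong3 p v" if v: "int_point v" for v
  proof -
    have "res3 v \<in> res3 ` pts" unfolding all by (rule res3_in)
    then obtain p where "p \<in> pts" "res3 p = res3 v" by force
    then show ?thesis using res3_eq_iff[of p v] v by (auto simp: pts_def)
  qed
qed

lemma bound_and_equality:
  shows "card pts \<le> 3 ^ (CARD('n) - 1) * (card ipts + 2)"
    and "card pts = 3 ^ (CARD('n) - 1) * (card ipts + 2) \<Longrightarrow>
      \<exists>j l. l \<ge> 1 \<and> unimod_equiv K (para j l)"
proof -
  have pow: "3 ^ (CARD('n) - 1) * 3 = (3::nat) ^ CARD('n)"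
    by (metis One_nat_def Suc_pred mult.commute power_Suc zero_less_card_finite)
  have "card pts \<le> 3 ^ (CARD('n) - 1) * (card ipts + 2) \<and>
    (card pts = 3 ^ (CARD('n) - 1) * (card ipts + 2) \<longrightarrow>
      (\<exists>j l. l \<ge> 1 \<and> unimod_equiv K (para j l)))"
  proof (cases "ipts = {0}")
    case True
    have "card pts = card (res3 ` pts)"
      using card_image[OF inj_on_res3_pts[OF True]] by simp
    also have "\<dots> \<le> card (PiE (UNIV::'n set) (\<lambda>_. {0..<3::int}))"
      by (rule card_mono[OF finite_residues]) (use res3_in in blast)
    finally have "card pts \<le> 3 ^ CARD('n)" by (simp only: card_residues)
    moreover have "\<exists>j l. l \<ge> 1 \<and> unimod_equiv K (para j l)" if "card pts = 3 ^ CARD('n)"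
    proof -
      interpret full_body K by (rule full_bodyI[OF True that])
      obtain f a where "dual_lattice_bases f a" "K = {x. \<forall>i. \<bar>a i \<bullet> x\<bar> \<le> 1}" using is_cube by blast
      \<comment> \<open>With length 1 all coordinates are alike, so any index can be the
        distinguished one.\<close>
      then have "unimod_equiv K (para undefined 1)"
        by (intro dual_lattice_bases_unimod_equiv) auto
      then show ?thesis by blast
    qed
    ultimately show ?thesis using pow True by simp
  next
    case False
    then obtain x where "x \<in> ipts" "x \<noteq> 0" using zero_ipts by blast
    then obtain w l where "long_body K w l" using exists_long_body by blast
    then interpret long_body K w l .
    have "\<exists>j l. l \<ge> 1 \<and> unimod_equiv K (para j l)"
      if "card pts = 3 ^ (CARD('n) - 1) * (card ipts + 2)"
    proof -
      interpret saturated_body K w l by (rule equality_saturated[OF that])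
      obtain f a j where "dual_lattice_bases f a"
        "K = {x. \<forall>i. \<bar>a i \<bullet> x\<bar> \<le> (if i = j then real l else 1)}" by (rule is_stretched_cube)
      then have "unimod_equiv K (para j l)" by (rule dual_lattice_bases_unimod_equiv)
      then show ?thesis using l_ge by (intro exI[of _ j] exI[of _ l]) simp
    qed
    then show ?thesis using card_pts_le by blast
  qed
  then show "card pts \<le> 3 ^ (CARD('n) - 1) * (card ipts + 2)"
    and "card pts = 3 ^ (CARD('n) - 1) * (card ipts + 2) \<Longrightarrow>
      \<exists>j l. l \<ge> 1 \<and> unimod_equiv K (para j l)" by blast+
qed

end

theorem theorem1p1:
  fixes K :: "(real^'n) set"
  assumes "convex_body K" and "origin_symmetric K"
  shows "G K \<le> 3 ^ (CARD('n) - 1) * (G (interior K) + 2)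
    \<and> (G K = 3 ^ (CARD('n) - 1) * (G (interior K) + 2)
         \<longleftrightarrow> (\<exists>(j::'n) (l::nat). l \<ge> 1 \<and> unimod_equiv K (para j l)))"
proof -
  interpret symmetric_body K using assms by (rule symmetric_bodyI)
  \<comment> \<open>The converse is a count: unimodular maps preserve both numbers, and for the box
    they are \<open>(2 * l + 1) * 3 ^ (CARD('n) - 1)\<close> and \<open>2 * l - 1\<close>.\<close>
  have "G K = 3 ^ (CARD('n) - 1) * (G (interior K) + 2)"
    if jl: "l \<ge> 1" "unimod_equiv K (para j l)" for j :: 'n and l
  proof -
    obtain A where A: "unimodular A" "K = (*v) A ` para j l"
      using jl(2) unfolding unimod_equiv_def by blast
    show ?thesis
      unfolding A(2) interior_unimodular_image[OF A(1)] G_unimodular_image[OF A(1)]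
        G_para G_interior_para[OF jl(1)] using jl(1) by simp
  qed
  then show ?thesis using bound_and_equality unfolding card_pts card_ipts by blast
qed

end
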